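(* Let $A, B$ be finitely generated groups and let $A *_C B$ be a proper amalgamated free product such that $\max\{[A:C], [B:C]\} \geq 3$. Then $\mathrm{girth}(A *_C B) = \infty$.
   Context: Given groups $A,B,C$ and monomorphisms $C \to A$, $C \to B$ (via which $C$ is identified with a subgroup of $A$ and of $B$), $A *_C B$ denotes the free product of $A$ and $B$ amalgamated over $C$. It is called proper if $C$ is a proper subgroup in both $A$ and $B$. Indices $[A:C]$, $[B:C]$ may be infinite. Girth: for a finitely generated group $\Gamma$ and a finite generating set $S$ of $\Gamma$, $\mathrm{girth}(\Gamma, S)$ is the length of the shortest non-trivial relation of $\Gamma$ with respect to $S$, i.e. the minimal length of a non-empty freely reduced word in the alphabet $S^{\pm 1}$ which represents the identity of $\Gamma$ (and $\infty$ if there is no such word). Then $\mathrm{girth}(\Gamma) = \sup\{\mathrm{girth}(\Gamma, S) : S \subset \Gamma,\ \langle S\rangle = \Gamma,\ |S| < \infty\}$. *)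

theory Defs
  imports "HOL-Algebra.Generated_Groups" "HOL-Library.Extended_Nat"
begin

subsection \<open>Finitely generated groups, index\<close>

definition finitely_generated :: "('a, 'm) monoid_scheme \<Rightarrow> bool" where
  "finitely_generated G \<longleftrightarrow> (\<exists>S. finite S \<and> S \<subseteq> carrier G \<and> generate G S = carrier G)"

definition subgroup_index :: "('a, 'm) monoid_scheme \<Rightarrow> 'a set \<Rightarrow> enat" where
  "subgroup_index G H = (if finite (rcosets\<^bsub>G\<^esub> H) then enat (card (rcosets\<^bsub>G\<^esub> H)) else \<infinity>)"

subsection \<open>Girth\<close>

text \<open>
  Words over \<open>S\<close> and its formal inverses: the letter \<open>(s, True)\<close> stands for \<open>s\<close> and
  \<open>(s, False)\<close> for the inverse of \<open>s\<close>.  Free reduction is formal, i.e. words represent elements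
  of the free group on \<open>S\<close>: if \<open>s\<close> and its inverse both belong to \<open>S\<close> they are
  different free generators, and their product is a non-trivial relation of length 2.
\<close>

definition letter_value :: "('a, 'm) monoid_scheme \<Rightarrow> 'a \<times> bool \<Rightarrow> 'a" where
  "letter_value G l = (if snd l then fst l else inv\<^bsub>G\<^esub> (fst l))"

definition word_value :: "('a, 'm) monoid_scheme \<Rightarrow> ('a \<times> bool) list \<Rightarrow> 'a" where
  "word_value G w = foldr (\<lambda>l x. letter_value G l \<otimes>\<^bsub>G\<^esub> x) w \<one>\<^bsub>G\<^esub>"

definition freely_reduced :: "('a \<times> bool) list \<Rightarrow> bool" where
  "freely_reduced w \<longleftrightarrow> successively (\<lambda>l m. \<not> (fst l = fst m \<and> snd l \<noteq> snd m)) w"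

text \<open>In \<^typ>\<open>enat\<close> the infimum of the empty set is \<open>\<infinity>\<close>.\<close>

definition girth_wrt :: "('a, 'm) monoid_scheme \<Rightarrow> 'a set \<Rightarrow> enat" where
  "girth_wrt G S = Inf {enat (length w) | w.
     w \<in> lists (S \<times> UNIV) \<and> w \<noteq> [] \<and> freely_reduced w \<and> word_value G w = \<one>\<^bsub>G\<^esub>}"

definition girth :: "('a, 'm) monoid_scheme \<Rightarrow> enat" where
  "girth G = Sup {girth_wrt G S | S. finite S \<and> S \<subseteq> carrier G \<and> generate G S = carrier G}"

subsection \<open>Amalgamated free products\<close>

text \<open>
  The free product of \<open>A\<close> and \<open>B\<close> amalgamated along \<open>f : C \<rightarrow> A\<close> and \<open>g : C \<rightarrow> B\<close> is the set
  of words in the disjoint union of \<open>A\<close> and \<open>B\<close>, modulo the congruence generated by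
  the multiplication in \<open>A\<close>, the multiplication in \<open>B\<close>, and \<open>f c = g c\<close> for \<open>c\<close> in \<open>C\<close>.
\<close>

abbreviation amalg_words :: "('a, 'm) monoid_scheme \<Rightarrow> ('b, 'n) monoid_scheme \<Rightarrow> ('a + 'b) list set" where
  "amalg_words A B \<equiv> lists (carrier A <+> carrier B)"

inductive amalg_eq ::
  "('a, 'm) monoid_scheme \<Rightarrow> ('b, 'n) monoid_scheme \<Rightarrow> ('c, 'k) monoid_scheme \<Rightarrow>
   ('c \<Rightarrow> 'a) \<Rightarrow> ('c \<Rightarrow> 'b) \<Rightarrow> ('a + 'b) list \<Rightarrow> ('a + 'b) list \<Rightarrow> bool"
  for A B C f g where
  refl: "w \<in> amalg_words A B \<Longrightarrow> amalg_eq A B C f g w w"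
| sym: "amalg_eq A B C f g v w \<Longrightarrow> amalg_eq A B C f g w v"
| trans: "amalg_eq A B C f g u v \<Longrightarrow> amalg_eq A B C f g v w \<Longrightarrow> amalg_eq A B C f g u w"
| append: "amalg_eq A B C f g u u' \<Longrightarrow> amalg_eq A B C f g v v' \<Longrightarrow>
    amalg_eq A B C f g (u @ v) (u' @ v')"
| one_left: "amalg_eq A B C f g [Inl \<one>\<^bsub>A\<^esub>] []"
| one_right: "amalg_eq A B C f g [Inr \<one>\<^bsub>B\<^esub>] []"
| mult_left: "a \<in> carrier A \<Longrightarrow> a' \<in> carrier A \<Longrightarrow>
    amalg_eq A B C f g [Inl a, Inl a'] [Inl (a \<otimes>\<^bsub>A\<^esub> a')]"
| mult_right: "b \<in> carrier B \<Longrightarrow> b' \<in> carrier B \<Longrightarrow>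
    amalg_eq A B C f g [Inr b, Inr b'] [Inr (b \<otimes>\<^bsub>B\<^esub> b')]"
| amalgamate: "c \<in> carrier C \<Longrightarrow> amalg_eq A B C f g [Inl (f c)] [Inr (g c)]"

definition amalg_rel ::
  "('a, 'm) monoid_scheme \<Rightarrow> ('b, 'n) monoid_scheme \<Rightarrow> ('c, 'k) monoid_scheme \<Rightarrow>
   ('c \<Rightarrow> 'a) \<Rightarrow> ('c \<Rightarrow> 'b) \<Rightarrow> (('a + 'b) list \<times> ('a + 'b) list) set" where
  "amalg_rel A B C f g = {(v, w). amalg_eq A B C f g v w}"

definition amalgamated_product ::
  "('a, 'm) monoid_scheme \<Rightarrow> ('b, 'n) monoid_scheme \<Rightarrow> ('c, 'k) monoid_scheme \<Rightarrow>
   ('c \<Rightarrow> 'a) \<Rightarrow> ('c \<Rightarrow> 'b) \<Rightarrow> ('a + 'b) list set monoid" where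
  "amalgamated_product A B C f g =
    \<lparr>carrier = amalg_words A B // amalg_rel A B C f g,
     mult = (\<lambda>X Y. \<Union>u\<in>X. \<Union>v\<in>Y. amalg_rel A B C f g `` {u @ v}),
     one = amalg_rel A B C f g `` {[]}\<rparr>"

definition amalg_inl where
  "amalg_inl A B C f g a = amalg_rel A B C f g `` {[Inl a]}"

definition amalg_inr where
  "amalg_inr A B C f g b = amalg_rel A B C f g `` {[Inr b]}"

subsection \<open>The amalgamated free product is a group and a pushout\<close>

locale amalgam =
  A: group A + B: group B + C: group C
  for A :: "('a, 'm) monoid_scheme" and B :: "('b, 'n) monoid_scheme"
    and C :: "('c, 'k) monoid_scheme" +
  fixes f :: "'c \<Rightarrow> 'a" and g :: "'c \<Rightarrow> 'b"
  assumes f_hom: "f \<in> hom C A" and g_hom: "g \<in> hom C B"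
begin

abbreviation "R \<equiv> amalg_rel A B C f g"
abbreviation "P \<equiv> amalgamated_product A B C f g"

lemma amalg_eq_words:
  "amalg_eq A B C f g v w \<Longrightarrow> v \<in> amalg_words A B \<and> w \<in> amalg_words A B"
  by (induction rule: amalg_eq.induct)
     (use f_hom g_hom in \<open>auto simp: hom_def Pi_def\<close>)

lemma equiv_R: "equiv (amalg_words A B) R"
proof (rule equivI)
  show "R \<subseteq> amalg_words A B \<times> amalg_words A B"
    using amalg_eq_words by (auto simp: amalg_rel_def)
  show "refl_on (amalg_words A B) R"
    by (auto simp: refl_on_def amalg_rel_def intro: amalg_eq.refl)
  show "sym R"
    by (auto simp: sym_def amalg_rel_def intro: amalg_eq.sym)
  show "trans R"
    unfolding trans_def amalg_rel_def by (blast intro: amalg_eq.trans)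
qed

lemma class_eq_iff:
  assumes "v \<in> amalg_words A B" "w \<in> amalg_words A B"
  shows "R `` {v} = R `` {w} \<longleftrightarrow> amalg_eq A B C f g v w"
  using eq_equiv_class_iff[OF equiv_R assms] by (simp add: amalg_rel_def)

lemma class_mult:
  assumes "v \<in> amalg_words A B" "w \<in> amalg_words A B"
  shows "R `` {v} \<otimes>\<^bsub>P\<^esub> R `` {w} = R `` {v @ w}"
proof -
  have "congruent2 R R (\<lambda>u v. R `` {u @ v})"
  proof (rule congruent2I')
    fix u u' v v' assume "(u, u') \<in> R" "(v, v') \<in> R"
    then have "(u @ v, u' @ v') \<in> R"
      by (auto simp: amalg_rel_def intro: amalg_eq.append)
    then show "R `` {u @ v} = R `` {u' @ v'}"
      by (rule equiv_class_eq[OF equiv_R])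
  qed
  then show ?thesis
    using UN_equiv_class2[OF equiv_R equiv_R _ assms] by (simp add: amalgamated_product_def)
qed

lemma carrier_P: "X \<in> carrier P \<longleftrightarrow> (\<exists>w \<in> amalg_words A B. X = R `` {w})"
  by (auto simp: amalgamated_product_def quotient_def)

lemma one_P: "\<one>\<^bsub>P\<^esub> = R `` {[]}"
  by (simp add: amalgamated_product_def)

lemma left_inverse_word:
  assumes "w \<in> amalg_words A B"
  shows "\<exists>v \<in> amalg_words A B. amalg_eq A B C f g (v @ w) []"
  using assms
proof (induction w)
  case Nil
  show ?case by (auto intro: amalg_eq.refl)
next
  case (Cons x w)
  then obtain v where v: "v \<in> amalg_words A B" "amalg_eq A B C f g (v @ w) []" by auto
  have "\<exists>y \<in> carrier A <+> carrier B. amalg_eq A B C f g [y, x] []"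
  proof (cases x)
    case (Inl a)
    with Cons.hyps(1) have a: "a \<in> carrier A" by (auto simp: Plus_def)
    have "amalg_eq A B C f g [Inl (inv\<^bsub>A\<^esub> a), Inl a] [Inl (inv\<^bsub>A\<^esub> a \<otimes>\<^bsub>A\<^esub> a)]"
      using a by (intro amalg_eq.mult_left) auto
    then have "amalg_eq A B C f g [Inl (inv\<^bsub>A\<^esub> a), x] []"
      using a Inl amalg_eq.one_left[of A B C f g] by (auto intro: amalg_eq.trans)
    with a show ?thesis by auto
  next
    case (Inr b)
    with Cons.hyps(1) have b: "b \<in> carrier B" by (auto simp: Plus_def)
    have "amalg_eq A B C f g [Inr (inv\<^bsub>B\<^esub> b), Inr b] [Inr (inv\<^bsub>B\<^esub> b \<otimes>\<^bsub>B\<^esub> b)]"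
      using b by (intro amalg_eq.mult_right) auto
    then have "amalg_eq A B C f g [Inr (inv\<^bsub>B\<^esub> b), x] []"
      using b Inr amalg_eq.one_right[of A B C f g] by (auto intro: amalg_eq.trans)
    with b show ?thesis by auto
  qed
  then obtain y where y: "y \<in> carrier A <+> carrier B" "amalg_eq A B C f g [y, x] []" by blast
  have w: "w \<in> amalg_words A B" by (rule Cons.hyps(2))
  have "amalg_eq A B C f g ([y, x] @ w) ([] @ w)"
    using y(2) w by (intro amalg_eq.append amalg_eq.refl)
  then have "amalg_eq A B C f g (v @ ([y, x] @ w)) (v @ ([] @ w))"
    by (rule amalg_eq.append[OF amalg_eq.refl[OF v(1)]])
  then have "amalg_eq A B C f g ((v @ [y]) @ (x # w)) []"
    using v(2) by (auto intro: amalg_eq.trans)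
  moreover have "v @ [y] \<in> amalg_words A B" using v(1) y(1) by simp
  ultimately show ?case by blast
qed

lemma group_P: "group P"
proof (rule groupI)
  fix X Y assume "X \<in> carrier P" "Y \<in> carrier P"
  then obtain v w where "v \<in> amalg_words A B" "w \<in> amalg_words A B" "X = R `` {v}" "Y = R `` {w}"
    unfolding carrier_P by blast
  then show "X \<otimes>\<^bsub>P\<^esub> Y \<in> carrier P"
    by (auto simp: class_mult carrier_P intro!: bexI[of _ "v @ w"])
next
  show "\<one>\<^bsub>P\<^esub> \<in> carrier P"
    by (auto simp: one_P carrier_P intro!: bexI[of _ "[]"])
next
  fix X Y Z assume "X \<in> carrier P" "Y \<in> carrier P" "Z \<in> carrier P"
  then obtain u v w where "u \<in> amalg_words A B" "v \<in> amalg_words A B" "w \<in> amalg_words A B"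
    "X = R `` {u}" "Y = R `` {v}" "Z = R `` {w}"
    unfolding carrier_P by blast
  then show "X \<otimes>\<^bsub>P\<^esub> Y \<otimes>\<^bsub>P\<^esub> Z = X \<otimes>\<^bsub>P\<^esub> (Y \<otimes>\<^bsub>P\<^esub> Z)"
    by (simp add: class_mult)
next
  fix X assume "X \<in> carrier P"
  then obtain w where "w \<in> amalg_words A B" "X = R `` {w}"
    unfolding carrier_P by blast
  then show "\<one>\<^bsub>P\<^esub> \<otimes>\<^bsub>P\<^esub> X = X"
    by (simp add: class_mult one_P)
next
  fix X assume "X \<in> carrier P"
  then obtain w where w: "w \<in> amalg_words A B" "X = R `` {w}"
    unfolding carrier_P by blast
  obtain v where v: "v \<in> amalg_words A B" "amalg_eq A B C f g (v @ w) []"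
    using left_inverse_word[OF w(1)] by blast
  have "R `` {v} \<otimes>\<^bsub>P\<^esub> X = \<one>\<^bsub>P\<^esub>"
    using v w class_eq_iff[of "v @ w" "[]"] by (simp add: class_mult one_P)
  moreover have "R `` {v} \<in> carrier P"
    using v(1) unfolding carrier_P by blast
  ultimately show "\<exists>Y \<in> carrier P. Y \<otimes>\<^bsub>P\<^esub> X = \<one>\<^bsub>P\<^esub>"
    by blast
qed

lemma amalg_inl_hom: "amalg_inl A B C f g \<in> hom A P"
proof (rule homI)
  fix x y assume xy: "x \<in> carrier A" "y \<in> carrier A"
  then show "amalg_inl A B C f g x \<in> carrier P"
    by (auto simp: amalg_inl_def carrier_P intro!: bexI[of _ "[Inl x]"])
  show "amalg_inl A B C f g (x \<otimes>\<^bsub>A\<^esub> y) = amalg_inl A B C f g x \<otimes>\<^bsub>P\<^esub> amalg_inl A B C f g y"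
    using xy class_eq_iff[of "[Inl (x \<otimes>\<^bsub>A\<^esub> y)]" "[Inl x, Inl y]"]
      amalg_eq.sym[OF amalg_eq.mult_left[OF xy, of B C f g]]
    by (simp add: amalg_inl_def class_mult InlI InrI)
qed

lemma amalg_inr_hom: "amalg_inr A B C f g \<in> hom B P"
proof (rule homI)
  fix x y assume xy: "x \<in> carrier B" "y \<in> carrier B"
  then show "amalg_inr A B C f g x \<in> carrier P"
    by (auto simp: amalg_inr_def carrier_P intro!: bexI[of _ "[Inr x]"])
  show "amalg_inr A B C f g (x \<otimes>\<^bsub>B\<^esub> y) = amalg_inr A B C f g x \<otimes>\<^bsub>P\<^esub> amalg_inr A B C f g y"
    using xy class_eq_iff[of "[Inr (x \<otimes>\<^bsub>B\<^esub> y)]" "[Inr x, Inr y]"]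
      amalg_eq.sym[OF amalg_eq.mult_right[OF xy, of A C f g]]
    by (simp add: amalg_inr_def class_mult InlI InrI)
qed

lemma amalg_commute:
  assumes "c \<in> carrier C"
  shows "amalg_inl A B C f g (f c) = amalg_inr A B C f g (g c)"
  using amalg_eq_words[OF amalg_eq.amalgamate[OF assms]] amalg_eq.amalgamate[OF assms]
    class_eq_iff[of "[Inl (f c)]" "[Inr (g c)]"]
  by (simp add: amalg_inl_def amalg_inr_def)

lemma amalg_universal:
  fixes H :: "('h, 'l) monoid_scheme"
  assumes H: "group H" and \<alpha>: "\<alpha> \<in> hom A H" and \<beta>: "\<beta> \<in> hom B H"
    and eq: "\<And>c. c \<in> carrier C \<Longrightarrow> \<alpha> (f c) = \<beta> (g c)"
  shows "\<exists>h \<in> hom P H. (\<forall>a \<in> carrier A. h (amalg_inl A B C f g a) = \<alpha> a) \<and>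
    (\<forall>b \<in> carrier B. h (amalg_inr A B C f g b) = \<beta> b)"
proof -
  interpret H: group H by (rule H)
  define e where "e w = foldr (\<lambda>l x. case_sum \<alpha> \<beta> l \<otimes>\<^bsub>H\<^esub> x) w \<one>\<^bsub>H\<^esub>" for w
  have e_simps [simp]: "e [] = \<one>\<^bsub>H\<^esub>" "\<And>x w. e (x # w) = case_sum \<alpha> \<beta> x \<otimes>\<^bsub>H\<^esub> e w"
    by (simp_all add: e_def)
  have a_cl [simp]: "\<alpha> a \<in> carrier H" if "a \<in> carrier A" for a
    using that \<alpha> by (auto simp: hom_def)
  have b_cl [simp]: "\<beta> b \<in> carrier H" if "b \<in> carrier B" for b
    using that \<beta> by (auto simp: hom_def)
  have e_cl [simp]: "e w \<in> carrier H" if "w \<in> amalg_words A B" for w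
    using that by (induction w) auto
  have e_app: "e (v @ w) = e v \<otimes>\<^bsub>H\<^esub> e w"
    if "v \<in> amalg_words A B" "w \<in> amalg_words A B" for v w
    using that
    by (induction v) (auto simp: H.m_assoc simp flip: in_lists_conv_set)
  have \<alpha>1: "\<alpha> \<one>\<^bsub>A\<^esub> = \<one>\<^bsub>H\<^esub>" using hom_one[OF \<alpha>] A.is_group H by blast
  have \<beta>1: "\<beta> \<one>\<^bsub>B\<^esub> = \<one>\<^bsub>H\<^esub>" using hom_one[OF \<beta>] B.is_group H by blast
  have inv: "e v = e w" if "amalg_eq A B C f g v w" for v w
    using that
  proof (induction rule: amalg_eq.induct)
    case (append u u' v v')
    then show ?case
      using amalg_eq_words[OF append.hyps(1)] amalg_eq_words[OF append.hyps(2)]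
      by (simp add: e_app)
  next
    case (mult_left a a')
    then show ?case using \<alpha> by (simp add: hom_mult)
  next
    case (mult_right b b')
    then show ?case using \<beta> by (simp add: hom_mult)
  qed (auto simp: \<alpha>1 \<beta>1 eq)
  define h where "h X = e (SOME w. w \<in> X)" for X
  have h: "h (R `` {w}) = e w" if w: "w \<in> amalg_words A B" for w
  proof -
    have "w \<in> R `` {w}" using w by (auto simp: amalg_rel_def intro: amalg_eq.refl)
    then have "(SOME v. v \<in> R `` {w}) \<in> R `` {w}" by (rule someI)
    then have "amalg_eq A B C f g w (SOME v. v \<in> R `` {w})" by (simp add: amalg_rel_def)
    from inv[OF this] show ?thesis by (simp add: h_def)
  qed
  show ?thesis
  proof (intro bexI conjI ballI)
    show "h \<in> hom P H"
    proof (rule homI)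
      fix X Y assume "X \<in> carrier P" "Y \<in> carrier P"
      then obtain v w where vw: "v \<in> amalg_words A B" "w \<in> amalg_words A B"
        "X = R `` {v}" "Y = R `` {w}"
        unfolding carrier_P by blast
      then show "h X \<in> carrier H" by (simp add: h)
      have "v @ w \<in> amalg_words A B" using vw by simp
      then show "h (X \<otimes>\<^bsub>P\<^esub> Y) = h X \<otimes>\<^bsub>H\<^esub> h Y"
        using vw by (simp only: class_mult h e_app)
    qed
  next
    fix a assume "a \<in> carrier A"
    then show "h (amalg_inl A B C f g a) = \<alpha> a"
      using h[of "[Inl a]"] by (simp add: amalg_inl_def InlI InrI)
  next
    fix b assume "b \<in> carrier B"
    then show "h (amalg_inr A B C f g b) = \<beta> b"
      using h[of "[Inr b]"] by (simp add: amalg_inr_def InlI InrI)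
  qed
qed

lemma amalg_universal_unique:
  fixes H :: "('h, 'l) monoid_scheme"
  assumes H: "group H" and h: "h \<in> hom P H" and k: "k \<in> hom P H"
    and l: "\<And>a. a \<in> carrier A \<Longrightarrow> h (amalg_inl A B C f g a) = k (amalg_inl A B C f g a)"
    and r: "\<And>b. b \<in> carrier B \<Longrightarrow> h (amalg_inr A B C f g b) = k (amalg_inr A B C f g b)"
    and U: "U \<in> carrier P"
  shows "h U = k U"
proof -
  obtain w where w: "w \<in> amalg_words A B" "U = R `` {w}"
    using U unfolding carrier_P by blast
  from w(1) have "h (R `` {w}) = k (R `` {w})"
  proof (induction w rule: lists.induct)
    case Nil
    show ?case using hom_one[OF h group_P H] hom_one[OF k group_P H] by (simp add: one_P)
  next
    case (Cons x w)
    have x: "[x] \<in> amalg_words A B" using Cons.hyps(1) by simp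
    have "h (R `` {[x]}) = k (R `` {[x]})"
      using Cons.hyps(1) l r by (cases x) (auto simp: amalg_inl_def amalg_inr_def)
    moreover have "R `` {x # w} = R `` {[x]} \<otimes>\<^bsub>P\<^esub> R `` {w}"
      using class_mult[OF x Cons.hyps(2)] by simp
    moreover have "R `` {[x]} \<in> carrier P" "R `` {w} \<in> carrier P"
      using x Cons.hyps(2) unfolding carrier_P by blast+
    ultimately show ?case
      using Cons.IH by (simp add: hom_mult[OF h] hom_mult[OF k])
  qed
  with w(2) show ?thesis by simp
qed

end

end

theory Submission
  imports Defs "HOL-Algebra.Bij"
begin

text \<open>
  Let \<open>y\<close> and a finite set \<open>T\<close> generate \<open>G\<close>, and suppose that \<open>G\<close> plays ping-pong: nonzero powers of
  \<open>y\<close> map \<open>P\<close> into \<open>Q\<close>, and each \<open>t\<^sup>\<plusminus>\<^sup>1\<close> with \<open>t \<in> T\<close> maps \<open>Q\<close> into \<open>P\<close>.  Replace each \<open>t\<close> by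
  \<open>y\<^sup>-\<^sup>i t y\<^sup>j\<close>, where all the exponents \<open>i, j\<close> are distinct positive multiples of \<open>n\<close>.  In a freely
  reduced word with fewer than \<open>n\<close> letters in \<open>y\<close> and these new generators, the powers of \<open>y\<close> between
  two occurrences of elements of \<open>T\<close> cannot cancel, so the word is nontrivial.

  In the amalgamated product choose \<open>a, a' \<in> A - C\<close> in different left and different right cosets of
  \<open>C\<close>, and \<open>b \<in> B - C\<close>, and put \<open>x = abab\<close>, \<open>y = a'ba'b\<close>.  The factors \<open>A\<close>, \<open>B\<close> are generated by finite
  sets outside \<open>C\<close>, and \<open>T\<close> consists of \<open>x\<close>, the \<open>x s x\<^sup>-\<^sup>1\<close> for the generators \<open>s\<close> of \<open>A\<close> and the
  \<open>x\<^sup>-\<^sup>1 s x\<close> for those of \<open>B\<close>.  In these conjugates the normal forms do not cancel around \<open>s\<close>.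
\<close>

section \<open>Ping-pong and girth\<close>

context group
begin

lemma inv_mult_cancel_left [simp]:
  assumes "x \<in> carrier G" "u \<in> carrier G"
  shows "inv x \<otimes> (x \<otimes> u) = u" "x \<otimes> (inv x \<otimes> u) = u"
  using assms by (simp_all flip: m_assoc)

text \<open>Induction from the right end of the word, keeping track of the leading power of
  \<open>y\<close>. Here \<open>c\<close> is the sum of the leading run of letters \<open>y\<close>,
  and \<open>m * l\<close> comes from the left exponent of the first other letter. Since
  \<open>\<bar>c\<bar> < m\<close>, the two contributions cannot compensate each other. Words in
  \<open>y\<close> alone have \<open>u = \<one>\<close>, hence
  \<open>insert \<one> P\<close>.\<close>

lemma freely_reduced_word_in_ping_pong:
  fixes m :: int and L :: "'a \<Rightarrow> bool \<Rightarrow> int"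
  assumes y: "y \<in> carrier G" and S: "S \<subseteq> carrier G" and P: "P \<subseteq> carrier G"
    and yP: "\<And>k::int. \<And>u. k \<noteq> 0 \<Longrightarrow> u \<in> insert \<one> P \<Longrightarrow> y [^] k \<otimes> u \<in> Q"
    and L_pos: "\<And>\<sigma> e. 0 < L \<sigma> e"
    and L_inj: "\<And>\<sigma> \<sigma>' e e'. \<sigma> \<in> S - {y} \<Longrightarrow> \<sigma>' \<in> S - {y} \<Longrightarrow> L \<sigma> e = L \<sigma>' e' \<Longrightarrow> \<sigma> = \<sigma>' \<and> e = e'"
    and letter: "\<And>\<sigma> e. \<sigma> \<in> S \<Longrightarrow> \<sigma> \<noteq> y \<Longrightarrow>
      \<exists>t \<in> carrier G. letter_value G (\<sigma>, e) = y [^] (- m * L \<sigma> e) \<otimes> (t \<otimes> y [^] (m * L \<sigma> (\<not> e)))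
        \<and> (\<forall>u\<in>Q. t \<otimes> u \<in> P)"
    and w: "w \<in> lists (S \<times> UNIV)" "freely_reduced w" "int (length w) < m"
  shows "\<exists>c l u. word_value G w = y [^] (c - m * l) \<otimes> u \<and> u \<in> insert \<one> P \<and>
    \<bar>c\<bar> \<le> int (length w) \<and>
    (case w of [] \<Rightarrow> c = 0 \<and> l = 0
      | (\<sigma>, e) # _ \<Rightarrow> if \<sigma> = y then c \<noteq> 0 \<and> (0 < c \<longleftrightarrow> e) else c = 0 \<and> l = L \<sigma> e)"
  using w
proof (induction w rule: list.induct)
  case Nil
  show ?case
    by (rule exI[of _ 0], rule exI[of _ 0], rule exI[of _ \<one>]) (simp add: word_value_def)
next
  case (Cons x w)
  obtain \<sigma> e where x: "x = (\<sigma>, e)" by (cases x)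
  have \<sigma>: "\<sigma> \<in> S" using Cons.prems(1) x by simp
  have red: "w = [] \<or> \<not> (\<sigma> = fst (hd w) \<and> e \<noteq> snd (hd w))" "freely_reduced w"
    using Cons.prems(2) x by (auto simp: freely_reduced_def successively_Cons)
  have len: "int (length w) < m" using Cons.prems(3) by simp
  obtain c l u where v: "word_value G w = y [^] (c - m * l) \<otimes> u" and u: "u \<in> insert \<one> P"
    and c: "\<bar>c\<bar> \<le> int (length w)"
    and hd: "case w of [] \<Rightarrow> c = 0 \<and> l = 0
      | (\<sigma>, e) # _ \<Rightarrow> if \<sigma> = y then c \<noteq> 0 \<and> (0 < c \<longleftrightarrow> e) else c = 0 \<and> l = L \<sigma> e"
    using Cons.IH Cons.prems(1) red(2) len by auto
  have ucl: "u \<in> carrier G" using u P by auto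
  have val: "word_value G (x # w) = letter_value G x \<otimes> (y [^] (c - m * l) \<otimes> u)"
    using v by (simp add: word_value_def)
  show ?case
  proof (cases "\<sigma> = y")
    case True
    define d :: int where "d = (if e then 1 else - 1)"
    have lv: "letter_value G x = y [^] d"
      using True x y by (simp add: letter_value_def d_def int_pow_neg)
    have "word_value G (x # w) = y [^] (d + (c - m * l)) \<otimes> u"
      using val lv y ucl int_pow_mult[OF y, of d "c - m * l"] by (simp add: m_assoc)
    then have 1: "word_value G (x # w) = y [^] ((d + c) - m * l) \<otimes> u"
      by (simp add: algebra_simps)
    \<comment> \<open>By free reduction a run of letters \<open>y\<close> has constant sign, so its
      exponents add up without cancellation.\<close>
    have "c = 0 \<or> (0 < c \<longleftrightarrow> e)"
      using hd red(1) True by (auto split: list.splits if_splits)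
    then have 2: "d + c \<noteq> 0 \<and> (0 < d + c \<longleftrightarrow> e)" "\<bar>d + c\<bar> \<le> int (length (x # w))"
      using c by (auto simp: d_def)
    show ?thesis
      by (rule exI[of _ "d + c"], rule exI[of _ l], rule exI[of _ u])
         (use 1 2 u x True in auto)
  next
    case False
    obtain t where t: "t \<in> carrier G" "\<forall>u\<in>Q. t \<otimes> u \<in> P"
      and lv: "letter_value G x = y [^] (- m * L \<sigma> e) \<otimes> (t \<otimes> y [^] (m * L \<sigma> (\<not> e)))"
      using letter[OF \<sigma> False, of e] x by auto
    \<comment> \<open>If this exponent vanished, \<open>m\<close> would divide \<open>c\<close>, so
      \<open>c = 0\<close> and \<open>l = L \<sigma> (\<not> e)\<close>. Then either
      \<open>w\<close> is empty and \<open>l = 0\<close>, against positivity, or by injectivity of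
      \<open>L\<close> it starts with the formal inverse of \<open>x\<close>, against free
      reduction.\<close>
    have ne: "m * L \<sigma> (\<not> e) + (c - m * l) \<noteq> 0"
    proof
      assume 0: "m * L \<sigma> (\<not> e) + (c - m * l) = 0"
      then have "c = m * (l - L \<sigma> (\<not> e))" by (simp add: algebra_simps)
      then have "m dvd c" by simp
      then have c0: "c = 0" using c len zdvd_not_zless[of "\<bar>c\<bar>" m] by (cases "c = 0") auto
      then have l: "l = L \<sigma> (\<not> e)" using 0 len by simp
      show False
      proof (cases w)
        case Nil
        then show ?thesis using hd l L_pos[of \<sigma> "\<not> e"] by simp
      next
        case (Cons x' w')
        obtain \<sigma>' e' where x': "x' = (\<sigma>', e')" by (cases x')
        have "\<sigma>' \<in> S" using Cons.prems(1) Cons x' by simp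
        moreover have "l = L \<sigma>' e'" "\<sigma>' \<noteq> y"
          using hd Cons x' c0 by (auto split: if_splits)
        ultimately show ?thesis
          using L_inj[of \<sigma> \<sigma>' "\<not> e" e'] l red(1) Cons x' \<sigma> False by auto
      qed
    qed
    define q where "q = y [^] (m * L \<sigma> (\<not> e) + (c - m * l)) \<otimes> u"
    have "q \<in> Q" unfolding q_def using yP[OF ne u] .
    then have tq: "t \<otimes> q \<in> P" using t(2) by blast
    have "word_value G (x # w) = y [^] (0 - m * L \<sigma> e) \<otimes> (t \<otimes> q)"
      unfolding val lv q_def int_pow_mult[OF y, of "m * L \<sigma> (\<not> e)"]
      using y t(1) ucl by (simp add: m_assoc)
    then show ?thesis using tq x False
      by (intro exI[of _ 0] exI[of _ "L \<sigma> e"] exI[of _ "t \<otimes> q"]) auto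
  qed
qed

text \<open>A relation shorter than \<open>n\<close> has value \<open>y [^] k \<otimes> u\<close>
  with \<open>k \<noteq> 0\<close> and \<open>u\<close> in \<open>insert \<one> P\<close>; this lies
  in \<open>Q\<close>, which omits \<open>\<one>\<close>.\<close>

lemma girth_wrt_ping_pong:
  fixes n :: nat and num :: "'a \<Rightarrow> nat"
  assumes y: "y \<in> carrier G" and T: "T \<subseteq> carrier G" and P: "P \<subseteq> carrier G"
    and num: "inj_on num T"
    and Q1: "\<one> \<notin> Q"
    and yP: "\<And>k::int. \<And>u. k \<noteq> 0 \<Longrightarrow> u \<in> insert \<one> P \<Longrightarrow> y [^] k \<otimes> u \<in> Q"
    and TQ: "\<And>t u. t \<in> T \<Longrightarrow> u \<in> Q \<Longrightarrow> t \<otimes> u \<in> P \<and> inv t \<otimes> u \<in> P"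
  defines "z \<equiv> \<lambda>t. y [^] (- int n * (2 * int (num t) + 1)) \<otimes> (t \<otimes> y [^] (int n * (2 * int (num t) + 2)))"
  shows "enat n \<le> girth_wrt G (insert y (z ` T))"
  unfolding girth_wrt_def
proof (rule Inf_greatest, rule ccontr)
  fix r assume r: "r \<in> {enat (length w) | w. w \<in> lists (insert y (z ` T) \<times> UNIV) \<and> w \<noteq> [] \<and>
    freely_reduced w \<and> word_value G w = \<one>}" and "\<not> enat n \<le> r"
  then obtain w where w: "w \<in> lists (insert y (z ` T) \<times> UNIV)" "w \<noteq> []" "freely_reduced w"
    "word_value G w = \<one>" "\<not> enat n \<le> enat (length w)" by blast
  then have len: "int (length w) < int n" by simp
  let ?S = "insert y (z ` T)"
  have inT: "inv_into T z \<sigma> \<in> T" "z (inv_into T z \<sigma>) = \<sigma>" if "\<sigma> \<in> z ` T" for \<sigma>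
    using that by (auto intro: inv_into_into f_inv_into_f)
  \<comment> \<open>The left exponent of the letter \<open>(\<sigma>, e)\<close> is
    \<open>- n * L \<sigma> e\<close>. Parity encodes the sign \<open>e\<close>, and
    \<open>num\<close> separates the generators through one chosen preimage under \<open>z\<close>
    for each.\<close>
  define L :: "'a \<Rightarrow> bool \<Rightarrow> int" where
    "L \<sigma> e = 2 * int (num (inv_into T z \<sigma>)) + (if e then 1 else 2)" for \<sigma> e
  have L_pos: "0 < L \<sigma> e" for \<sigma> e by (simp add: L_def)
  have L_inj: "\<sigma> = \<sigma>' \<and> e = e'"
    if "\<sigma> \<in> ?S - {y}" "\<sigma>' \<in> ?S - {y}" "L \<sigma> e = L \<sigma>' e'" for \<sigma> \<sigma>' e e'
  proof -
    have "num (inv_into T z \<sigma>) = num (inv_into T z \<sigma>') \<and> e = e'"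
      using that(3) unfolding L_def by (cases e; cases e'; simp; presburger)
    then show ?thesis using that(1,2) inT num by (metis Diff_iff inj_onD insertE singletonI)
  qed
  have zcl: "z t \<in> carrier G" if "t \<in> T" for t using that T y by (auto simp: z_def)
  then have S: "?S \<subseteq> carrier G" using y by auto
  have letter: "\<exists>t \<in> carrier G. letter_value G (\<sigma>, e)
        = y [^] (- int n * L \<sigma> e) \<otimes> (t \<otimes> y [^] (int n * L \<sigma> (\<not> e)))
      \<and> (\<forall>u\<in>Q. t \<otimes> u \<in> P)"
    if \<sigma>: "\<sigma> \<in> ?S" "\<sigma> \<noteq> y" for \<sigma> e
  proof -
    define t where "t = inv_into T z \<sigma>"
    have t: "t \<in> T" "z t = \<sigma>" using inT[of \<sigma>] \<sigma> unfolding t_def by auto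
    have tcl: "t \<in> carrier G" using t T by auto
    show ?thesis
    proof (cases e)
      case True
      have "L \<sigma> True = 2 * int (num t) + 1" "L \<sigma> False = 2 * int (num t) + 2"
        by (simp_all add: L_def t_def)
      then show ?thesis using True t tcl TQ[OF t(1)]
        by (intro bexI[of _ t]) (auto simp: letter_value_def z_def)
    next
      case False
      have L: "L \<sigma> True = 2 * int (num t) + 1" "L \<sigma> False = 2 * int (num t) + 2"
        by (simp_all add: L_def t_def)
      \<comment> \<open>Inversion swaps the two exponents, so the right exponent of a letter is the
        one attached to the opposite sign.\<close>
      have "inv (z t) = y [^] (- int n * (2 * int (num t) + 2)) \<otimes>
          (inv t \<otimes> y [^] (int n * (2 * int (num t) + 1)))"
        unfolding z_def using y tcl by (simp add: inv_mult_group m_assoc flip: int_pow_neg)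
      then show ?thesis using False t tcl L TQ[OF t(1)]
        by (intro bexI[of _ "inv t"]) (auto simp: letter_value_def)
    qed
  qed
  obtain c l u where v: "word_value G w = y [^] (c - int n * l) \<otimes> u" and u: "u \<in> insert \<one> P"
    and c: "\<bar>c\<bar> \<le> int (length w)"
    and hd: "case w of [] \<Rightarrow> c = 0 \<and> l = 0
      | (\<sigma>, e) # _ \<Rightarrow> if \<sigma> = y then c \<noteq> 0 \<and> (0 < c \<longleftrightarrow> e) else c = 0 \<and> l = L \<sigma> e"
    using freely_reduced_word_in_ping_pong[OF y S P yP L_pos L_inj letter w(1,3) len] by blast
  have "L \<sigma> e \<noteq> 0" for \<sigma> e using L_pos[of \<sigma> e] by simp
  \<comment> \<open>Nonemptiness of \<open>w\<close> enters here. Together with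
    \<open>\<bar>c\<bar> < n\<close> it excludes \<open>c = n * l\<close>.\<close>
  then have "c \<noteq> 0 \<or> l \<noteq> 0" using hd w(2) by (auto split: list.splits if_splits)
  moreover have "c = 0" if "c = int n * l"
    using that c len zdvd_not_zless[of "\<bar>c\<bar>" "int n"] by (cases "c = 0") auto
  ultimately have "c - int n * l \<noteq> 0" using len by auto
  from yP[OF this u] have "word_value G w \<in> Q" using v by simp
  then show False using w(4) Q1 by simp
qed

text \<open>For every \<open>n\<close> the exchange of each \<open>t\<close> for \<open>z t\<close>
  preserves the generated subgroup, because \<open>y\<close> stays among the generators and its
  powers undo the exchange. So there are finite generating sets of girth at least
  \<open>n\<close>.\<close>

lemma girth_eq_infinity_ping_pong:
  assumes y: "y \<in> carrier G" and T: "T \<subseteq> carrier G" "finite T" and P: "P \<subseteq> carrier G"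
    and gen: "generate G (insert y T) = carrier G"
    and Q1: "\<one> \<notin> Q"
    and yP: "\<And>k::int. \<And>u. k \<noteq> 0 \<Longrightarrow> u \<in> insert \<one> P \<Longrightarrow> y [^] k \<otimes> u \<in> Q"
    and TQ: "\<And>t u. t \<in> T \<Longrightarrow> u \<in> Q \<Longrightarrow> t \<otimes> u \<in> P \<and> inv t \<otimes> u \<in> P"
  shows "girth G = \<infinity>"
proof -
  obtain num :: "'a \<Rightarrow> nat" where num: "inj_on num T"
    using finite_imp_inj_to_nat_seg[OF T(2)] by auto
  have "enat n \<le> girth G" for n
  proof -
    define z where "z \<equiv> \<lambda>t. y [^] (- int n * (2 * int (num t) + 1)) \<otimes>
      (t \<otimes> y [^] (int n * (2 * int (num t) + 2)))"
    let ?S = "insert y (z ` T)"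
    have S: "?S \<subseteq> carrier G" using y T by (auto simp: z_def)
    interpret H: subgroup "generate G ?S" G by (rule generate_is_subgroup[OF S])
    have yk: "y [^] (k::int) \<in> generate G ?S" for k
      using subgroup_int_pow_closed[OF generate_is_subgroup[OF S]] generate.incl[of y ?S] by blast
    have "t \<in> generate G ?S" if "t \<in> T" for t
    proof -
      have tcl: "t \<in> carrier G" using that T by auto
      let ?i = "int n * (2 * int (num t) + 1)" and ?j = "int n * (2 * int (num t) + 2)"
      have "t = y [^] ?i \<otimes> (z t \<otimes> y [^] (- ?j))"
        unfolding z_def using y tcl by (simp add: m_assoc int_pow_neg)
      moreover have "z t \<in> generate G ?S" using that by (auto intro: generate.incl)
      ultimately show ?thesis using yk by (metis H.m_closed)
    qed
    then have "insert y T \<subseteq> generate G ?S" by (auto intro: generate.incl)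
    then have "generate G ?S = carrier G"
      using generate_subgroup_incl[OF _ generate_is_subgroup[OF S]] gen H.subset by blast
    then have "girth_wrt G ?S \<le> girth G"
      unfolding girth_def using S T(2) by (intro Sup_upper) blast
    moreover have "enat n \<le> girth_wrt G ?S"
      unfolding z_def using girth_wrt_ping_pong[OF y T(1) P num Q1 yP TQ] by blast
    ultimately show ?thesis by (rule order_trans[rotated])
  qed
  then show ?thesis by (metis enat_ile enat_ord_simps(1) not_less_eq_eq order_refl enat.exhaust)
qed

text \<open>The set \<open>M\<close> (resp. \<open>N\<close>) stands for the elements whose normal form starts with a syllable in
  \<open>D\<close> (resp. \<open>E\<close>).\<close>

lemma ping_pong_step:
  assumes D: "D \<subseteq> carrier G" "\<And>d. d \<in> D \<Longrightarrow> inv d \<in> D"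
    and E: "E \<subseteq> carrier G" "\<And>d. d \<in> E \<Longrightarrow> inv d \<in> E"
    and MN: "M \<subseteq> carrier G" "N \<subseteq> carrier G"
    and DN: "\<And>d u. d \<in> D \<Longrightarrow> u \<in> insert \<one> N \<Longrightarrow> d \<otimes> u \<in> M"
    and EM: "\<And>d u. d \<in> E \<Longrightarrow> u \<in> insert \<one> M \<Longrightarrow> d \<otimes> u \<in> N"
    and a: "a \<in> D" "a' \<in> D" "inv a \<otimes> a' \<in> D" "a \<otimes> inv a' \<in> D" and b: "b \<in> E"
    and U_def: "\<And>a. U a = (\<lambda>m. a \<otimes> (b \<otimes> m)) ` M"
    and V_def: "\<And>a. V a = (\<lambda>m. inv b \<otimes> (inv a \<otimes> m)) ` N"
  defines "x \<equiv> a \<otimes> (b \<otimes> (a \<otimes> b))"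
  shows "U a \<subseteq> M" "V a \<subseteq> N"
    "u \<in> insert \<one> (M \<union> V a') \<Longrightarrow> x \<otimes> u \<in> U a"
    "u \<in> insert \<one> (N \<union> U a') \<Longrightarrow> inv x \<otimes> u \<in> V a"
proof -
  have cl [simp]: "a \<in> carrier G" "a' \<in> carrier G" "b \<in> carrier G"
    using a b D(1) E(1) by auto
  have clM [simp]: "u \<in> M \<Longrightarrow> u \<in> carrier G" and clN [simp]: "u \<in> N \<Longrightarrow> u \<in> carrier G" for u
    using MN by auto
  have DN': "d \<in> D \<Longrightarrow> u \<in> N \<Longrightarrow> d \<otimes> u \<in> M" and EM': "d \<in> E \<Longrightarrow> u \<in> M \<Longrightarrow> d \<otimes> u \<in> N" for d u
    using DN EM by auto
  have D1: "d \<in> M" if "d \<in> D" for d using DN[OF that, of \<one>] that D(1) by auto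
  have E1: "d \<in> N" if "d \<in> E" for d using EM[OF that, of \<one>] that E(1) by auto
  note [simp] = DN' EM' D1 E1 D(2) E(2) a b
  have invx: "inv x = inv b \<otimes> (inv a \<otimes> (inv b \<otimes> inv a))"
    by (simp add: x_def inv_mult_group m_assoc)
  show "U a \<subseteq> M" "V a \<subseteq> N" by (auto simp: U_def V_def)
  show "x \<otimes> u \<in> U a" if u: "u \<in> insert \<one> (M \<union> V a')"
  proof -
    consider "u = \<one>" | "u \<in> M" | n where "n \<in> N" "u = inv b \<otimes> (inv a' \<otimes> n)"
      using u by (auto simp: V_def)
    then have "\<exists>m \<in> M. x \<otimes> u = a \<otimes> (b \<otimes> m)"
    proof cases
      case 1 then show ?thesis by (intro bexI[of _ "a \<otimes> b"]) (auto simp: x_def)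
    next
      case 2 then show ?thesis by (intro bexI[of _ "a \<otimes> (b \<otimes> u)"]) (auto simp: x_def m_assoc)
    next
      \<comment> \<open>The only cancellation: \<open>b\<close> meets \<open>inv b\<close>, and then
        \<open>a\<close> meets \<open>inv a'\<close>. It stops there because
        \<open>a \<otimes> inv a'\<close> is again in \<open>D\<close>.\<close>
      case 3
      have "(a \<otimes> inv a') \<otimes> n \<in> M" using 3 by simp
      then show ?thesis using 3
        by (intro bexI[of _ "(a \<otimes> inv a') \<otimes> n"]) (simp_all add: x_def m_assoc)
    qed
    then show ?thesis by (auto simp: U_def)
  qed
  show "inv x \<otimes> u \<in> V a" if u: "u \<in> insert \<one> (N \<union> U a')"
  proof -
    consider "u = \<one>" | "u \<in> N" | m where "m \<in> M" "u = a' \<otimes> (b \<otimes> m)"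
      using u by (auto simp: U_def)
    then have "\<exists>n \<in> N. inv x \<otimes> u = inv b \<otimes> (inv a \<otimes> n)"
    proof cases
      case 1 then show ?thesis by (intro bexI[of _ "inv b \<otimes> inv a"]) (auto simp: invx)
    next
      case 2 then show ?thesis by (intro bexI[of _ "inv b \<otimes> (inv a \<otimes> u)"]) (auto simp: invx m_assoc)
    next
      \<comment> \<open>Here \<open>inv a\<close> meets \<open>a'\<close>; the product stays in
        \<open>D\<close>, so it can be followed by \<open>b \<otimes> m\<close> in \<open>N\<close>
        and preceded by \<open>inv b\<close>.\<close>
      case 3
      have "inv b \<otimes> ((inv a \<otimes> a') \<otimes> (b \<otimes> m)) \<in> N" using 3 by simp
      then show ?thesis using 3
        by (intro bexI[of _ "inv b \<otimes> ((inv a \<otimes> a') \<otimes> (b \<otimes> m))"]) (simp_all add: invx m_assoc)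
    qed
    then show ?thesis by (auto simp: V_def)
  qed
qed

text \<open>Ping-pong with the powers of \<open>y\<close> against \<open>T\<close>: \<open>P\<close>
  collects elements that begin like a nonzero power of \<open>x\<close>, and \<open>Q\<close> those
  that begin like a nonzero power of \<open>y\<close>. The conditions on \<open>a\<close> and
  \<open>a'\<close> bound the cancellation between the two kinds.\<close>

lemma girth_eq_infinity_alternating:
  assumes D: "D \<subseteq> carrier G" "\<And>d. d \<in> D \<Longrightarrow> inv d \<in> D"
    and E: "E \<subseteq> carrier G" "\<And>d. d \<in> E \<Longrightarrow> inv d \<in> E"
    and MN: "M \<subseteq> carrier G" "N \<subseteq> carrier G" "M \<inter> N = {}" "\<one> \<notin> M \<union> N"
    and DN: "\<And>d u. d \<in> D \<Longrightarrow> u \<in> insert \<one> N \<Longrightarrow> d \<otimes> u \<in> M"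
    and EM: "\<And>d u. d \<in> E \<Longrightarrow> u \<in> insert \<one> M \<Longrightarrow> d \<otimes> u \<in> N"
    and a: "a \<in> D" "a' \<in> D" "inv a \<otimes> a' \<in> D" "a \<otimes> inv a' \<in> D" and b: "b \<in> E"
    and X: "finite X" "X \<subseteq> D" and Y: "finite Y" "Y \<subseteq> E"
    and gen: "generate G (X \<union> Y) = carrier G"
  shows "girth G = \<infinity>"
proof -
  have cl [simp]: "a \<in> carrier G" "a' \<in> carrier G" "b \<in> carrier G"
    using a b D(1) E(1) by auto
  have "inv (inv a \<otimes> a') \<in> D" "inv (a \<otimes> inv a') \<in> D" using a D(2) by blast+
  then have a2: "inv a' \<otimes> a \<in> D" "a' \<otimes> inv a \<in> D"
    by (simp_all add: inv_mult_group)
  define x where "x = a \<otimes> (b \<otimes> (a \<otimes> b))"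
  define y where "y = a' \<otimes> (b \<otimes> (a' \<otimes> b))"
  define U where "U a = (\<lambda>m. a \<otimes> (b \<otimes> m)) ` M" for a
  define V where "V a = (\<lambda>m. inv b \<otimes> (inv a \<otimes> m)) ` N" for a
  note step = ping_pong_step[OF D E MN(1,2) DN EM a b U_def V_def, folded x_def]
  \<comment> \<open>The same facts with \<open>a\<close> and \<open>a'\<close> interchanged;
    \<open>a2\<close> supplies the inverted conditions on them.\<close>
  note step' = ping_pong_step[OF D E MN(1,2) DN EM a(2,1) a2 b U_def V_def, folded y_def]
  have xcl [simp]: "x \<in> carrier G" and ycl [simp]: "y \<in> carrier G"
    by (auto simp: x_def y_def)
  define T where "T = insert x ((\<lambda>s. x \<otimes> (s \<otimes> inv x)) ` X \<union> (\<lambda>s. inv x \<otimes> (s \<otimes> x)) ` Y)"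
  define P where "P = U a \<union> V a"
  define Q where "Q = U a' \<union> V a'"
  have Xcl: "s \<in> carrier G" if "s \<in> X \<union> Y" for s using that X Y D E by auto
  have Tcl: "T \<subseteq> carrier G" using Xcl by (auto simp: T_def)
  show ?thesis
  proof (rule girth_eq_infinity_ping_pong[of y T P Q])
    show "finite T" using X Y by (simp add: T_def)
    show P: "P \<subseteq> carrier G" using step(1,2) MN by (auto simp: P_def)
    show "\<one> \<notin> Q" using step'(1,2) MN by (auto simp: Q_def)
    show "generate G (insert y T) = carrier G"
    proof -
      have S: "insert y T \<subseteq> carrier G" using Tcl by simp
      interpret H: subgroup "generate G (insert y T)" G by (rule generate_is_subgroup[OF S])
      have x: "x \<in> generate G (insert y T)" by (rule generate.incl) (simp add: T_def)
      have "s \<in> generate G (insert y T)" if "s \<in> X" for s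
      proof -
        have "x \<otimes> (s \<otimes> inv x) \<in> generate G (insert y T)"
          using that by (intro generate.incl) (simp add: T_def)
        then have "inv x \<otimes> ((x \<otimes> (s \<otimes> inv x)) \<otimes> x) \<in> generate G (insert y T)"
          using x by auto
        then show ?thesis using Xcl[of s] that by (simp add: m_assoc)
      qed
      moreover have "s \<in> generate G (insert y T)" if "s \<in> Y" for s
      proof -
        have "inv x \<otimes> (s \<otimes> x) \<in> generate G (insert y T)"
          using that by (intro generate.incl) (simp add: T_def)
        then have "x \<otimes> ((inv x \<otimes> (s \<otimes> x)) \<otimes> inv x) \<in> generate G (insert y T)"
          using x by auto
        then show ?thesis using Xcl[of s] that by (simp add: m_assoc)
      qed
      ultimately have "X \<union> Y \<subseteq> generate G (insert y T)" by auto
      then show ?thesis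
        using generate_subgroup_incl[OF _ generate_is_subgroup[OF S]] gen H.subset by blast
    qed
  next
    fix k :: int and u assume k: "k \<noteq> 0" and u: "u \<in> insert \<one> P"
    have ucl: "u \<in> carrier G" using u step(1,2) MN by (auto simp: P_def)
    \<comment> \<open>The first factor carries \<open>insert \<one> P\<close> into
      \<open>U a'\<close> (for \<open>y\<close>) or \<open>V a'\<close> (for \<open>inv y\<close>).
      Further factors stay there, since \<open>U a'\<close> lies in \<open>M\<close> and
      \<open>V a'\<close> in \<open>N\<close>.\<close>
    have "y [^] Suc i \<otimes> u \<in> U a' \<and> inv y [^] Suc i \<otimes> u \<in> V a'" for i :: nat
    proof (induction i)
      case 0
      show ?case using u step(1,2) step'(3,4)[of u] by (auto simp: P_def)
    next
      case (Suc i)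
      have "y [^] Suc (Suc i) \<otimes> u = y \<otimes> (y [^] Suc i \<otimes> u)"
        "inv y [^] Suc (Suc i) \<otimes> u = inv y \<otimes> (inv y [^] Suc i \<otimes> u)"
        using ucl nat_pow_Suc2[of y "Suc i"] nat_pow_Suc2[of "inv y" "Suc i"]
        by (simp_all add: m_assoc del: nat_pow_Suc)
      then show ?case using Suc step'(1,2) step'(3,4) by (auto simp del: nat_pow_Suc)
    qed note pow = this
    show "y [^] k \<otimes> u \<in> Q"
    proof (cases "k > 0")
      case True
      then obtain i where "k = int (Suc i)" by (metis Suc_pred zero_less_imp_eq_int)
      then show ?thesis using pow[of i] by (simp add: int_pow_int Q_def del: nat_pow_Suc of_nat_Suc)
    next
      case False
      then obtain i where "k = - int (Suc i)" using k
        by (metis Suc_pred int_cases3 of_nat_0_less_iff)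
      then have "y [^] k = inv y [^] Suc i"
        by (simp only: int_pow_neg_int[OF ycl] nat_pow_inv[OF ycl])
      then show ?thesis using pow[of i] by (simp add: Q_def del: nat_pow_Suc)
    qed
  next
    fix t u assume t: "t \<in> T" and u: "u \<in> Q"
    have ucl: "u \<in> carrier G" using u step'(1,2) MN by (auto simp: Q_def)
    have xu: "x \<otimes> u \<in> U a" "inv x \<otimes> u \<in> V a"
      using u step(3,4)[of u] step'(1,2) by (auto simp: Q_def)
    \<comment> \<open>\<open>inv x\<close> takes \<open>u\<close> into \<open>V a\<close>, hence
      into \<open>N\<close>; there \<open>s\<close> in \<open>D\<close> leads to \<open>M\<close>,
      and \<open>x\<close> takes \<open>M\<close> into \<open>U a\<close>. For \<open>s\<close> in
      \<open>E\<close> the roles of \<open>x\<close> and \<open>inv x\<close> are exchanged.\<close>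
    have conjX: "x \<otimes> (s \<otimes> inv x) \<otimes> u \<in> P" if "s \<in> D" for s
    proof -
      have s: "s \<in> carrier G" using that D by auto
      have "s \<otimes> (inv x \<otimes> u) \<in> M" using DN[OF that] xu step(2) by auto
      then have "x \<otimes> (s \<otimes> (inv x \<otimes> u)) \<in> U a" using step(3) by auto
      then show ?thesis using s ucl by (simp add: P_def m_assoc)
    qed
    have conjY: "inv x \<otimes> (s \<otimes> x) \<otimes> u \<in> P" if "s \<in> E" for s
    proof -
      have s: "s \<in> carrier G" using that E by auto
      have "s \<otimes> (x \<otimes> u) \<in> N" using EM[OF that] xu step(1) by auto
      then have "inv x \<otimes> (s \<otimes> (x \<otimes> u)) \<in> V a" using step(4) by auto
      then show ?thesis using s ucl by (simp add: P_def m_assoc)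
    qed
    consider "t = x" | s where "s \<in> X" "t = x \<otimes> (s \<otimes> inv x)"
      | s where "s \<in> Y" "t = inv x \<otimes> (s \<otimes> x)"
      using t by (auto simp: T_def)
    then show "t \<otimes> u \<in> P \<and> inv t \<otimes> u \<in> P"
    proof cases
      case 1 then show ?thesis using xu by (simp add: P_def)
    next
      case 2
      then have "inv t = x \<otimes> (inv s \<otimes> inv x)" using Xcl[of s] by (simp add: inv_mult_group m_assoc)
      then show ?thesis using 2 X D(2) conjX by auto
    next
      case 3
      then have "inv t = inv x \<otimes> (inv s \<otimes> x)" using Xcl[of s] by (simp add: inv_mult_group m_assoc)
      then show ?thesis using 3 Y E(2) conjY by auto
    qed
  qed (use Tcl in auto)
qed

section \<open>Elements and generators outside a subgroup\<close>

text \<open>Take \<open>p\<close>, \<open>q\<close> outside \<open>H\<close> in different right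
  cosets. If they share a left coset, then \<open>inv p\<close> and \<open>inv q\<close> do not
  share one, so one of them, \<open>t\<close>, avoids the left coset of \<open>p\<close> and
  \<open>q\<close>. As \<open>t\<close> cannot be in the right cosets of both \<open>p\<close> and
  \<open>q\<close>, pairing it with one of them works.\<close>

lemma exists_distinct_left_right_cosets:
  assumes H: "subgroup H G" and idx: "3 \<le> subgroup_index G H"
  obtains a a' where "a \<in> carrier G - H" "a' \<in> carrier G - H"
    "inv a \<otimes> a' \<in> carrier G - H" "a \<otimes> inv a' \<in> carrier G - H"
proof -
  interpret H: subgroup H G by (rule H)
  have "\<exists>X \<subseteq> rcosets H. card X = 3 \<and> finite X"
  proof (cases "finite (rcosets H)")
    case True
    then have "3 \<le> card (rcosets H)" using idx by (simp add: subgroup_index_def numeral_eq_enat)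
    then show ?thesis by (meson obtain_subset_with_card_n)
  next
    case False
    then show ?thesis using infinite_arbitrarily_large by blast
  qed
  then obtain X where X: "X \<subseteq> rcosets H" "card X = 3" "finite X" by blast
  \<comment> \<open>Discarding the trivial coset puts the two representatives outside
    \<open>H\<close>.\<close>
  then have "card (X - {H}) \<ge> 2" using card_Diff1_le[of X H] by (simp add: card_Diff_singleton_if)
  then obtain Z where "Z \<subseteq> X - {H}" "card Z = 2" by (meson obtain_subset_with_card_n)
  then obtain K K' where K: "K \<in> X" "K' \<in> X" "K \<noteq> H" "K' \<noteq> H" "K \<noteq> K'"
    by (auto simp: card_2_iff)
  have "K \<in> rcosets H" "K' \<in> rcosets H" using K(1,2) X(1) by (simp_all add: subsetD)
  then obtain p q where pq: "p \<in> carrier G" "q \<in> carrier G" "K = H #> p" "K' = H #> q"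
    by (auto simp: RCOSETS_def)
  have eqI: "H #> s = H #> t" if "s \<in> carrier G" "t \<in> carrier G" "s \<otimes> inv t \<in> H" for s t
    using H.rcos_module[OF is_group that(2,1)] that(3) repr_independence[OF _ that(2) H, of s] by simp
  have pq': "p \<notin> H" "q \<notin> H" "p \<otimes> inv q \<notin> H"
    using coset_join2[OF pq(1) H] coset_join2[OF pq(2) H] eqI[OF pq(1,2)] pq(3,4) K(3-5) by auto
  have l_tr: "inv s \<otimes> u \<in> H" if "inv s \<otimes> t \<in> H" "inv t \<otimes> u \<in> H"
    "s \<in> carrier G" "t \<in> carrier G" "u \<in> carrier G" for s t u
    using H.m_closed[OF that(1,2)] that(3-) by (simp add: m_assoc)
  have r_tr: "s \<otimes> inv u \<in> H" if "s \<otimes> inv t \<in> H" "t \<otimes> inv u \<in> H"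
    "s \<in> carrier G" "t \<in> carrier G" "u \<in> carrier G" for s t u
    using H.m_closed[OF that(1,2)] that(3-) by (simp add: m_assoc)
  have l_sym: "inv t \<otimes> s \<in> H" if "inv s \<otimes> t \<in> H" "s \<in> carrier G" "t \<in> carrier G" for s t
    using H.m_inv_closed[OF that(1)] that(2-) by (simp add: inv_mult_group)
  have r_sym: "t \<otimes> inv s \<in> H" if "s \<otimes> inv t \<in> H" "s \<in> carrier G" "t \<in> carrier G" for s t
    using H.m_inv_closed[OF that(1)] that(2-) by (simp add: inv_mult_group)
  have invH: "inv s \<in> H \<longleftrightarrow> s \<in> H" if "s \<in> carrier G" for s
    using H.m_inv_closed[of s] H.m_inv_closed[of "inv s"] that by auto
  show thesis
  proof (cases "inv p \<otimes> q \<in> H")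
    case False
    then show thesis using that pq pq' by auto
  next
    case True
    text \<open>\<open>p\<close> and \<open>q\<close> lie in the same left coset, but \<open>inv p\<close> and \<open>inv q\<close> do not.\<close>
    have "\<exists>t \<in> {inv p, inv q}. inv p \<otimes> t \<notin> H"
    proof (rule ccontr)
      assume "\<not> ?thesis"
      then have "inv p \<otimes> inv p \<in> H" "inv p \<otimes> inv q \<in> H" by auto
      then have "inv (inv p) \<otimes> inv q \<in> H"
        using l_tr[OF l_sym[of p "inv p"], of "inv q"] pq by auto
      then show False using pq pq' by simp
    qed
    then obtain t where t: "t \<in> {inv p, inv q}" "inv p \<otimes> t \<notin> H" by blast
    then have t': "t \<in> carrier G" "t \<notin> H" using pq pq' invH by auto
    have qt: "inv q \<otimes> t \<notin> H" using l_tr[OF True, of t] t t' pq by blast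
    show thesis
    proof (cases "p \<otimes> inv t \<in> H")
      case False
      then show thesis using that[of p t] t t' pq pq' by auto
    next
      case True
      then have "q \<otimes> inv t \<notin> H"
        using r_tr[OF True r_sym[of q t]] t' pq pq' by blast
      then show thesis using that[of q t] qt t' pq pq' by auto
    qed
  qed
qed

text \<open>With \<open>d\<close> outside \<open>H\<close>, replace every generator \<open>k\<close>
  in \<open>H\<close> by \<open>d \<otimes> k\<close>, which lies outside \<open>H\<close>, and add
  \<open>d\<close> itself to recover \<open>k\<close>.\<close>

lemma finitely_generated_outside_subgroup:
  assumes fg: "finitely_generated G" and H: "subgroup H G" and proper: "H \<subset> carrier G"
  obtains S where "finite S" "S \<subseteq> carrier G - H" "generate G S = carrier G"
proof -
  interpret H: subgroup H G by (rule H)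
  obtain K where K: "finite K" "K \<subseteq> carrier G" "generate G K = carrier G"
    using fg by (auto simp: finitely_generated_def)
  obtain d where d: "d \<in> carrier G" "d \<notin> H" using proper by blast
  define S where "S = insert d ((K - H) \<union> (\<lambda>k. d \<otimes> k) ` (K \<inter> H))"
  have "d \<otimes> k \<notin> H" if "k \<in> H" for k
  proof
    assume "d \<otimes> k \<in> H"
    then have "(d \<otimes> k) \<otimes> inv k \<in> H" using that by blast
    then show False using that d by (simp add: m_assoc)
  qed
  then have SH: "S \<subseteq> carrier G - H" using K(2) d by (auto simp: S_def)
  then have SG: "S \<subseteq> carrier G" by blast
  interpret S: subgroup "generate G S" G by (rule generate_is_subgroup[OF SG])
  have "k \<in> generate G S" if k: "k \<in> K" for k
  proof (cases "k \<in> H")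
    case True
    have "d \<in> generate G S" "d \<otimes> k \<in> generate G S"
      using k True by (auto simp: S_def intro: generate.incl)
    then have "inv d \<otimes> (d \<otimes> k) \<in> generate G S" by blast
    then show ?thesis using d True by simp
  next
    case False
    then show ?thesis using k by (auto simp: S_def intro: generate.incl)
  qed
  then have "generate G S = carrier G"
    using generate_subgroup_incl[OF subsetI S.subgroup_axioms, of K] K(3) S.subset by blast
  moreover have "finite S" using K(1) by (simp add: S_def)
  ultimately show thesis using SH that by blast
qed

end

section \<open>The action on normal forms\<close>

text \<open>An element of the amalgamated product with normal form \<open>c t\<^sub>1 \<dots> t\<^sub>n\<close>, where the \<open>t\<^sub>i\<close> are
  representatives of nontrivial right cosets, is encoded as \<open>(c, [t\<^sub>1, \<dots>, t\<^sub>n])\<close>.  With \<open>c\<close> in front,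
  left multiplication by a factor only changes \<open>c\<close> and the first syllable.\<close>

definition coset_rep :: "('a, 'm) monoid_scheme \<Rightarrow> 'a set \<Rightarrow> 'a \<Rightarrow> 'a" where
  "coset_rep A H a = (if a \<in> H then \<one>\<^bsub>A\<^esub> else (SOME x. x \<in> H #>\<^bsub>A\<^esub> a))"

definition coset_reps :: "('a, 'm) monoid_scheme \<Rightarrow> 'a set \<Rightarrow> 'a set" where
  "coset_reps A H = coset_rep A H ` (carrier A - H)"

section \<open>Right coset representatives\<close>

context group
begin

context
  fixes H assumes H: "subgroup H G"
begin

interpretation H: subgroup H G by (rule H)

lemma coset_rep_in_coset:
  assumes "a \<in> carrier G" shows "coset_rep G H a \<in> H #> a"
proof (cases "a \<in> H")
  case True
  then show ?thesis using coset_join2[OF assms H] by (simp add: coset_rep_def)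
next
  case False
  then show ?thesis using someI[of "\<lambda>x. x \<in> H #> a", OF rcos_self[OF assms H]]
    by (simp add: coset_rep_def)
qed

lemma coset_rep_closed:
  assumes "a \<in> carrier G" shows "coset_rep G H a \<in> carrier G"
  using coset_rep_in_coset[OF assms] r_coset_subset_G[OF H.subset assms] by blast

lemma mult_inv_coset_rep:
  assumes "a \<in> carrier G" shows "a \<otimes> inv (coset_rep G H a) \<in> H"
proof -
  have "coset_rep G H a \<otimes> inv a \<in> H"
    using H.rcos_module_imp[OF is_group assms coset_rep_in_coset[OF assms]] .
  then have "inv (coset_rep G H a \<otimes> inv a) \<in> H" by blast
  then show ?thesis using assms coset_rep_closed[OF assms] by (simp add: inv_mult_group)
qed

lemma mult_in_subgroup_iff:
  assumes "h \<in> H" "a \<in> carrier G" shows "h \<otimes> a \<in> H \<longleftrightarrow> a \<in> H"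
proof
  assume "h \<otimes> a \<in> H"
  then have "inv h \<otimes> (h \<otimes> a) \<in> H" using assms(1) by blast
  then show "a \<in> H" using assms by simp
qed (use assms in blast)

text \<open>The choice depends only on the coset \<open>H #> a\<close>, and so does membership in
  \<open>H\<close>.\<close>

lemma coset_rep_mult:
  assumes h: "h \<in> H" and a: "a \<in> carrier G"
  shows "coset_rep G H (h \<otimes> a) = coset_rep G H a"
proof -
  have "h \<otimes> a \<in> H #> a" using h by (auto simp: r_coset_def)
  then have "H #> (h \<otimes> a) = H #> a" using repr_independence[OF _ a H] by simp
  then show ?thesis using mult_in_subgroup_iff[OF h a] by (simp add: coset_rep_def)
qed

lemma coset_repsE:
  assumes "t \<in> coset_reps G H"
  shows "t \<in> carrier G" "t \<notin> H" "coset_rep G H t = t"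
proof -
  obtain a where a: "a \<in> carrier G" "a \<notin> H" "t = coset_rep G H a"
    using assms by (auto simp: coset_reps_def)
  show t: "t \<in> carrier G" using a coset_rep_closed by simp
  obtain h where h: "h \<in> H" "t = h \<otimes> a"
    using coset_rep_in_coset[OF a(1)] a(3) by (auto simp: r_coset_def)
  show "t \<notin> H" using h a mult_in_subgroup_iff by blast
  show "coset_rep G H t = t" using coset_rep_mult[OF h(1) a(1)] h a by simp
qed

end

end

section \<open>Action of one factor on normal forms\<close>

text \<open>\<open>N\<close> stands for the words not starting with a syllable of \<open>A\<close>,
  and \<open>N'\<close> for those that do. Computing normal forms is a bijection
  \<open>\<phi>\<close> from \<open>carrier A \<times> N\<close> onto \<open>\<Omega>\<close>. Left
  multiplication on the first component, transported along \<open>\<phi>\<close>, is the action, so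
  the homomorphism law reduces to associativity.\<close>

lemma coset_action:
  fixes A :: "('a, 'm) monoid_scheme" and C :: "('c, 'k) monoid_scheme" and e :: "'a \<Rightarrow> 'd"
    and N :: "'d list set"
  assumes A: "group A" and C: "group C" and f: "f \<in> mon C A"
    and e: "inj e" and N: "\<And>t r. e t # r \<notin> N"
  defines "N' \<equiv> {e t # r | t r. t \<in> coset_reps A (f ` carrier C) \<and> r \<in> N}"
  defines "\<Omega> \<equiv> carrier C \<times> (N \<union> N')"
  obtains act where "act \<in> hom A (BijGroup \<Omega>)"
    and "\<And>c d w. c \<in> carrier C \<Longrightarrow> d \<in> carrier C \<Longrightarrow> w \<in> N \<union> N' \<Longrightarrow> act (f c) (d, w) = (c \<otimes>\<^bsub>C\<^esub> d, w)"
    and "\<And>a d r. a \<in> carrier A - f ` carrier C \<Longrightarrow> d \<in> carrier C \<Longrightarrow> r \<in> N \<Longrightarrow>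
      act a (d, r) \<in> carrier C \<times> N'"
proof -
  interpret A: group A by (rule A)
  interpret C: group C by (rule C)
  have fh: "f \<in> hom C A" and finj: "inj_on f (carrier C)" using f by (auto simp: mon_def)
  interpret f: group_hom C A f by unfold_locales (rule fh)
  let ?H = "f ` carrier C"
  have H: "subgroup ?H A" using f.img_is_subgroup .
  interpret H: subgroup ?H A by (rule H)
  let ?rep = "coset_rep A ?H"
  define fi where "fi = inv_into (carrier C) f"
  have fi: "fi (f c) = c" if "c \<in> carrier C" for c using that finj by (simp add: fi_def)
  have fi_cl: "fi h \<in> carrier C" "f (fi h) = h" if "h \<in> ?H" for h
    using that by (auto simp: fi_def inv_into_into f_inv_into_f)
  \<comment> \<open>Split \<open>\<alpha>\<close> as an element of the image of \<open>C\<close>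
    times its representative: \<open>fi\<close> reads off the \<open>C\<close>-part, and the
    representative becomes a new syllable unless it is trivial.\<close>
  define \<phi> where "\<phi> = (\<lambda>(\<alpha>, r). (fi (\<alpha> \<otimes>\<^bsub>A\<^esub> inv\<^bsub>A\<^esub> (?rep \<alpha>)), if \<alpha> \<in> ?H then r else e (?rep \<alpha>) # r))"
  let ?X = "carrier A \<times> N"
  have \<phi>_in: "\<phi> (\<alpha>, r) \<in> carrier C \<times> (if \<alpha> \<in> ?H then N else N')" if "\<alpha> \<in> carrier A" "r \<in> N" for \<alpha> r
    using that fi_cl(1)[OF A.mult_inv_coset_rep[OF H that(1)]]
    by (auto simp: \<phi>_def N'_def coset_reps_def)
  have \<phi>_f: "\<phi> (f c \<otimes>\<^bsub>A\<^esub> \<alpha>, r) = (c \<otimes>\<^bsub>C\<^esub> fst (\<phi> (\<alpha>, r)), snd (\<phi> (\<alpha>, r)))"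
    if c: "c \<in> carrier C" and \<alpha>: "\<alpha> \<in> carrier A" for c \<alpha> r
  proof -
    have h: "f c \<in> ?H" using c by blast
    have m: "\<alpha> \<otimes>\<^bsub>A\<^esub> inv\<^bsub>A\<^esub> (?rep \<alpha>) \<in> ?H" by (rule A.mult_inv_coset_rep[OF H \<alpha>])
    then obtain d where d: "d \<in> carrier C" "\<alpha> \<otimes>\<^bsub>A\<^esub> inv\<^bsub>A\<^esub> (?rep \<alpha>) = f d" by blast
    have "f c \<otimes>\<^bsub>A\<^esub> \<alpha> \<otimes>\<^bsub>A\<^esub> inv\<^bsub>A\<^esub> (?rep \<alpha>) = f (c \<otimes>\<^bsub>C\<^esub> d)"
      using c d \<alpha> A.coset_rep_closed[OF H \<alpha>] by (simp add: A.m_assoc)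
    then have "fi (f c \<otimes>\<^bsub>A\<^esub> \<alpha> \<otimes>\<^bsub>A\<^esub> inv\<^bsub>A\<^esub> (?rep \<alpha>)) = c \<otimes>\<^bsub>C\<^esub> fi (\<alpha> \<otimes>\<^bsub>A\<^esub> inv\<^bsub>A\<^esub> (?rep \<alpha>))"
      using c d fi by (simp del: f.hom_mult)
    then show ?thesis
      using A.coset_rep_mult[OF H h \<alpha>] A.mult_in_subgroup_iff[OF H h \<alpha>] by (simp add: \<phi>_def)
  qed
  have \<phi>_one: "\<phi> (\<one>\<^bsub>A\<^esub>, r) = (\<one>\<^bsub>C\<^esub>, r)" for r
    using fi[OF C.one_closed] H.one_closed by (simp add: \<phi>_def coset_rep_def)
  have \<phi>_rep: "\<phi> (t, r) = (\<one>\<^bsub>C\<^esub>, e t # r)" if "t \<in> coset_reps A ?H" for t r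
    using A.coset_repsE[OF H that] fi[OF C.one_closed] by (simp add: \<phi>_def)
  have bij: "bij_betw \<phi> ?X \<Omega>"
  proof (rule bij_betw_imageI)
    show "inj_on \<phi> ?X"
    proof (rule inj_onI, clarify)
      fix \<alpha> r \<beta> s assume *: "\<alpha> \<in> carrier A" "r \<in> N" "\<beta> \<in> carrier A" "s \<in> N" "\<phi> (\<alpha>, r) = \<phi> (\<beta>, s)"
      have "fi (\<alpha> \<otimes>\<^bsub>A\<^esub> inv\<^bsub>A\<^esub> (?rep \<alpha>)) = fi (\<beta> \<otimes>\<^bsub>A\<^esub> inv\<^bsub>A\<^esub> (?rep \<beta>))"
        using *(5) by (simp add: \<phi>_def)
      then have 1: "\<alpha> \<otimes>\<^bsub>A\<^esub> inv\<^bsub>A\<^esub> (?rep \<alpha>) = \<beta> \<otimes>\<^bsub>A\<^esub> inv\<^bsub>A\<^esub> (?rep \<beta>)"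
        using fi_cl(2) A.mult_inv_coset_rep[OF H] *(1,3) by metis
      \<comment> \<open>No word in \<open>N\<close> starts with an \<open>e\<close>-letter, so the
        word shows whether a syllable was added. The representatives therefore agree, and the equal
        \<open>C\<close>-parts give \<open>\<alpha> = \<beta>\<close>.\<close>
      have "(if \<alpha> \<in> ?H then r else e (?rep \<alpha>) # r) = (if \<beta> \<in> ?H then s else e (?rep \<beta>) # s)"
        using *(5) by (simp add: \<phi>_def)
      then have "?rep \<alpha> = ?rep \<beta> \<and> r = s"
        using N *(2,4) e by (auto simp: coset_rep_def[of A] inj_eq split: if_splits)
      then show "\<alpha> = \<beta> \<and> r = s"
        using 1 *(1,3) A.coset_rep_closed[OF H *(1)] by (simp add: A.right_cancel)
    qed
    show "\<phi> ` ?X = \<Omega>"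
    proof
      show "\<phi> ` ?X \<subseteq> \<Omega>" using \<phi>_in unfolding \<Omega>_def by (fastforce split: if_splits)
      show "\<Omega> \<subseteq> \<phi> ` ?X"
      proof
        fix \<omega> assume "\<omega> \<in> \<Omega>"
        then obtain c w where \<omega>: "\<omega> = (c, w)" "c \<in> carrier C" "w \<in> N \<union> N'"
          unfolding \<Omega>_def by auto
        \<comment> \<open>By equivariance under \<open>C\<close> it is enough to reach
          \<open>(\<one>, w)\<close>: from \<open>\<one>\<close> if \<open>w\<close> is in
          \<open>N\<close>, otherwise from the first syllable and the tail.\<close>
        obtain \<alpha> r where "\<alpha> \<in> carrier A" "r \<in> N" "\<phi> (\<alpha>, r) = (\<one>\<^bsub>C\<^esub>, w)"
        proof (cases "w \<in> N")
          case True then show ?thesis using that[of "\<one>\<^bsub>A\<^esub>" w] \<phi>_one by simp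
        next
          case False
          then obtain t r where "w = e t # r" "t \<in> coset_reps A ?H" "r \<in> N"
            using \<omega> by (auto simp: N'_def)
          then show ?thesis using that[of t r] \<phi>_rep A.coset_repsE(1)[OF H] by simp
        qed
        then show "\<omega> \<in> \<phi> ` ?X" using \<phi>_f[of c \<alpha> r] \<omega>
          by (intro image_eqI[of _ _ "(f c \<otimes>\<^bsub>A\<^esub> \<alpha>, r)"]) auto
      qed
    qed
  qed
  define \<psi> where "\<psi> = inv_into ?X \<phi>"
  have \<psi>: "\<psi> (\<phi> u) = u" if "u \<in> ?X" for u
    using that bij by (simp add: \<psi>_def bij_betw_inv_into_left)
  have \<psi>_in: "\<psi> \<omega> \<in> ?X" "\<phi> (\<psi> \<omega>) = \<omega>" if "\<omega> \<in> \<Omega>" for \<omega>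
    using that bij bij_betw_inv_into[OF bij] unfolding \<psi>_def
    by (auto simp: bij_betw_inv_into_right bij_betw_apply)
  \<comment> \<open>The restriction to \<open>\<Omega>\<close> is there because members of
    \<open>BijGroup\<close> are extensional functions.\<close>
  define act where "act a = (\<lambda>\<omega>\<in>\<Omega>. \<phi> (a \<otimes>\<^bsub>A\<^esub> fst (\<psi> \<omega>), snd (\<psi> \<omega>)))" for a
  have act: "act a (\<phi> (\<alpha>, r)) = \<phi> (a \<otimes>\<^bsub>A\<^esub> \<alpha>, r)" if "\<alpha> \<in> carrier A" "r \<in> N" for a \<alpha> r
    using that bij_betw_apply[OF bij, of "(\<alpha>, r)"] \<psi>[of "(\<alpha>, r)"] by (simp add: act_def)
  have \<Omega>E: "\<exists>\<alpha> r. \<alpha> \<in> carrier A \<and> r \<in> N \<and> \<omega> = \<phi> (\<alpha>, r)" if "\<omega> \<in> \<Omega>" for \<omega>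
    using \<psi>_in[OF that] by (metis mem_Times_iff prod.collapse)
  have \<phi>\<Omega>: "\<phi> (\<alpha>, r) \<in> \<Omega>" if "\<alpha> \<in> carrier A" "r \<in> N" for \<alpha> r
    using that bij_betw_apply[OF bij] by simp
  have act_cl: "act a \<omega> \<in> \<Omega>" if "a \<in> carrier A" "\<omega> \<in> \<Omega>" for a \<omega>
    using \<Omega>E[OF that(2)] that(1) act \<phi>\<Omega> by auto
  have act_mult: "act (a \<otimes>\<^bsub>A\<^esub> b) \<omega> = act a (act b \<omega>)"
    if "a \<in> carrier A" "b \<in> carrier A" "\<omega> \<in> \<Omega>" for a b \<omega>
    using \<Omega>E[OF that(3)] that(1,2) by (auto simp: act A.m_assoc)
  have act_one: "act \<one>\<^bsub>A\<^esub> \<omega> = \<omega>" if "\<omega> \<in> \<Omega>" for \<omega>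
    using \<Omega>E[OF that] by (auto simp: act)
  have act_bij: "act a \<in> Bij \<Omega>" if a: "a \<in> carrier A" for a
  proof -
    have act_inv: "act (inv\<^bsub>A\<^esub> a) (act a \<omega>) = \<omega>" "act a (act (inv\<^bsub>A\<^esub> a) \<omega>) = \<omega>" if "\<omega> \<in> \<Omega>" for \<omega>
      using that a act_mult[of "inv\<^bsub>A\<^esub> a" a \<omega>] act_mult[of a "inv\<^bsub>A\<^esub> a" \<omega>] act_one[of \<omega>] by simp_all
    have "bij_betw (act a) \<Omega> \<Omega>"
      by (rule bij_betw_byWitness[where f' = "act (inv\<^bsub>A\<^esub> a)"])
         (use a act_cl act_inv in auto)
    then show ?thesis by (simp add: Bij_def act_def)
  qed
  have "act \<in> hom A (BijGroup \<Omega>)"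
  proof (rule homI)
    fix a b assume ab: "a \<in> carrier A" "b \<in> carrier A"
    show "act a \<in> carrier (BijGroup \<Omega>)" using act_bij[OF ab(1)] by (simp add: BijGroup_def)
    have "act (a \<otimes>\<^bsub>A\<^esub> b) = compose \<Omega> (act a) (act b)"
    proof (rule extensionalityI)
      show "act (a \<otimes>\<^bsub>A\<^esub> b) \<in> extensional \<Omega>" by (simp add: act_def)
    qed (use ab act_mult in \<open>auto simp: compose_def\<close>)
    then show "act (a \<otimes>\<^bsub>A\<^esub> b) = act a \<otimes>\<^bsub>BijGroup \<Omega>\<^esub> act b"
      using act_bij ab by (simp add: BijGroup_def)
  qed
  moreover have "act (f c) (d, w) = (c \<otimes>\<^bsub>C\<^esub> d, w)"
    if "c \<in> carrier C" "d \<in> carrier C" "w \<in> N \<union> N'" for c d w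
  proof -
    have "(d, w) \<in> \<Omega>" using that by (simp add: \<Omega>_def)
    then obtain \<alpha> r where \<alpha>: "\<alpha> \<in> carrier A" "r \<in> N" "(d, w) = \<phi> (\<alpha>, r)" using \<Omega>E by blast
    then show ?thesis using act \<phi>_f[OF that(1) \<alpha>(1), of r] by (metis fst_conv snd_conv)
  qed
  moreover have "act a (d, r) \<in> carrier C \<times> N'"
    if "a \<in> carrier A - ?H" "d \<in> carrier C" "r \<in> N" for a d r
  proof -
    \<comment> \<open>As \<open>f d\<close> has the trivial representative, acting by
      \<open>a\<close> gives \<open>\<phi>\<close> at \<open>a \<otimes> f d\<close>; this element
      is outside the image of \<open>C\<close>, so a syllable appears.\<close>
    have dr: "(d, r) = \<phi> (f d, r)"
      using \<phi>_f[OF that(2) A.one_closed, of r] that(2) \<phi>_one by simp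
    have "a \<otimes>\<^bsub>A\<^esub> f d \<notin> ?H"
    proof
      assume "a \<otimes>\<^bsub>A\<^esub> f d \<in> ?H"
      then have "(a \<otimes>\<^bsub>A\<^esub> f d) \<otimes>\<^bsub>A\<^esub> inv\<^bsub>A\<^esub> (f d) \<in> ?H" using that(2) by blast
      then show False using that by (simp add: A.m_assoc)
    qed
    then show ?thesis
      using dr act[of "f d" r a] that \<phi>_in[of "a \<otimes>\<^bsub>A\<^esub> f d" r] by simp
  qed
  ultimately show thesis using that by blast
qed

section \<open>Partition of the amalgamated product by first syllable\<close>

context amalgam
begin

text \<open>Both factors act on the same set of normal forms and agree on \<open>C\<close>, so the
  universal property makes \<open>P\<close> act. The image of the empty normal form under
  \<open>x\<close> is the normal form of \<open>x\<close>, and its first syllable decides between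
  \<open>M\<close> and \<open>N\<close>.\<close>

lemma normal_form_partition:
  assumes f: "f \<in> mon C A" and g: "g \<in> mon C B"
  obtains M N where "M \<subseteq> carrier P" "N \<subseteq> carrier P" "M \<inter> N = {}" "\<one>\<^bsub>P\<^esub> \<notin> M \<union> N"
    and "\<And>d u. d \<in> amalg_inl A B C f g ` (carrier A - f ` carrier C) \<Longrightarrow> u \<in> insert \<one>\<^bsub>P\<^esub> N \<Longrightarrow>
      d \<otimes>\<^bsub>P\<^esub> u \<in> M"
    and "\<And>d u. d \<in> amalg_inr A B C f g ` (carrier B - g ` carrier C) \<Longrightarrow> u \<in> insert \<one>\<^bsub>P\<^esub> M \<Longrightarrow>
      d \<otimes>\<^bsub>P\<^esub> u \<in> N"
proof -
  let ?TA = "coset_reps A (f ` carrier C)" and ?TB = "coset_reps B (g ` carrier C)"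
  \<comment> \<open>\<open>W\<close> consists of the alternating words. \<open>NA\<close> and
    \<open>NB\<close> are those that a syllable of \<open>A\<close>, respectively \<open>B\<close>,
    can be put in front of.\<close>
  define W where "W = {w \<in> lists (Inl ` ?TA \<union> Inr ` ?TB). successively (\<lambda>x y. isl x \<noteq> isl y) w}"
  define NA where "NA = {w \<in> W. w = [] \<or> \<not> isl (hd w)}"
  define NB where "NB = {w \<in> W. w = [] \<or> isl (hd w)}"
  have NA': "{Inl t # r | t r. t \<in> ?TA \<and> r \<in> NA} = {w \<in> W. w \<noteq> [] \<and> isl (hd w)}" (is "?NA' = _")
  proof (intro equalityI subsetI)
    fix w assume "w \<in> {w \<in> W. w \<noteq> [] \<and> isl (hd w)}"
    then show "w \<in> ?NA'"
      by (cases w) (auto simp: W_def NA_def successively_Cons)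
  qed (auto simp: W_def NA_def successively_Cons)
  have NB': "{Inr t # r | t r. t \<in> ?TB \<and> r \<in> NB} = {w \<in> W. w \<noteq> [] \<and> \<not> isl (hd w)}" (is "?NB' = _")
  proof (intro equalityI subsetI)
    fix w assume "w \<in> {w \<in> W. w \<noteq> [] \<and> \<not> isl (hd w)}"
    then show "w \<in> ?NB'"
      by (cases w) (auto simp: W_def NB_def successively_Cons)
  qed (auto simp: W_def NB_def successively_Cons)
  \<comment> \<open>This identifies the sets on which the two factors act.\<close>
  have WA: "NA \<union> ?NA' = W" and WB: "NB \<union> ?NB' = W"
    unfolding NA' NB' by (auto simp: NA_def NB_def)
  let ?\<Omega> = "carrier C \<times> W"
  obtain \<alpha> where \<alpha>: "\<alpha> \<in> hom A (BijGroup ?\<Omega>)"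
      "\<And>c d w. c \<in> carrier C \<Longrightarrow> d \<in> carrier C \<Longrightarrow> w \<in> W \<Longrightarrow> \<alpha> (f c) (d, w) = (c \<otimes>\<^bsub>C\<^esub> d, w)"
      "\<And>a d r. a \<in> carrier A - f ` carrier C \<Longrightarrow> d \<in> carrier C \<Longrightarrow> r \<in> NA \<Longrightarrow>
        \<alpha> a (d, r) \<in> carrier C \<times> ?NA'"
    using coset_action[OF A.is_group C.is_group f, of Inl NA] unfolding WA by (auto simp: NA_def)
  obtain \<beta> where \<beta>: "\<beta> \<in> hom B (BijGroup ?\<Omega>)"
      "\<And>c d w. c \<in> carrier C \<Longrightarrow> d \<in> carrier C \<Longrightarrow> w \<in> W \<Longrightarrow> \<beta> (g c) (d, w) = (c \<otimes>\<^bsub>C\<^esub> d, w)"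
      "\<And>b d r. b \<in> carrier B - g ` carrier C \<Longrightarrow> d \<in> carrier C \<Longrightarrow> r \<in> NB \<Longrightarrow>
        \<beta> b (d, r) \<in> carrier C \<times> ?NB'"
    using coset_action[OF B.is_group C.is_group g, of Inr NB] unfolding WB by (auto simp: NB_def)
  have "\<alpha> (f c) = \<beta> (g c)" if c: "c \<in> carrier C" for c
  proof (rule extensionalityI[of _ ?\<Omega>])
    show "\<alpha> (f c) \<in> extensional ?\<Omega>"
      using hom_in_carrier[OF \<alpha>(1), of "f c"] hom_in_carrier[OF f_hom c]
      by (simp add: BijGroup_def Bij_def)
    show "\<beta> (g c) \<in> extensional ?\<Omega>"
      using hom_in_carrier[OF \<beta>(1), of "g c"] hom_in_carrier[OF g_hom c]
      by (simp add: BijGroup_def Bij_def)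
  qed (use \<alpha>(2) \<beta>(2) c in auto)
  then obtain h where h: "h \<in> hom P (BijGroup ?\<Omega>)"
      "\<And>a. a \<in> carrier A \<Longrightarrow> h (amalg_inl A B C f g a) = \<alpha> a"
      "\<And>b. b \<in> carrier B \<Longrightarrow> h (amalg_inr A B C f g b) = \<beta> b"
    using amalg_universal[OF group_BijGroup \<alpha>(1) \<beta>(1)] by blast
  interpret P: group P by (rule group_P)
  let ?p = "(\<one>\<^bsub>C\<^esub>, [])"
  have p: "?p \<in> ?\<Omega>" by (simp add: W_def)
  have h1: "h \<one>\<^bsub>P\<^esub> ?p = ?p"
    using hom_one[OF h(1) group_P group_BijGroup] p by (simp add: BijGroup_def)
  have hm: "h (x \<otimes>\<^bsub>P\<^esub> y) ?p = h x (h y ?p)" if "x \<in> carrier P" "y \<in> carrier P" for x y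
    using that hom_mult[OF h(1) that] hom_in_carrier[OF h(1)] p by (simp add: BijGroup_def compose_def)
  define M where "M = {x \<in> carrier P. h x ?p \<in> carrier C \<times> ?NA'}"
  define N where "N = {x \<in> carrier P. h x ?p \<in> carrier C \<times> ?NB'}"
  show thesis
  proof (rule that[of M N])
    show "M \<subseteq> carrier P" "N \<subseteq> carrier P" by (auto simp: M_def N_def)
    show "M \<inter> N = {}" by (auto simp: M_def N_def)
    show "\<one>\<^bsub>P\<^esub> \<notin> M \<union> N" by (auto simp: M_def N_def h1)
  next
    fix d u assume d: "d \<in> amalg_inl A B C f g ` (carrier A - f ` carrier C)"
      and u: "u \<in> insert \<one>\<^bsub>P\<^esub> N"
    obtain a where a: "a \<in> carrier A - f ` carrier C" "d = amalg_inl A B C f g a" using d by blast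
    have cl: "d \<in> carrier P" "u \<in> carrier P"
      using a u hom_in_carrier[OF amalg_inl_hom, of a] by (auto simp: N_def)
    \<comment> \<open>The word of \<open>u\<close> is empty or starts with a syllable of
      \<open>B\<close>, so multiplication by \<open>a\<close> adds a syllable in front.\<close>
    have "h u ?p \<in> carrier C \<times> NA"
      using u h1 p unfolding N_def NB' by (auto simp: NA_def)
    then obtain c r where cr: "h u ?p = (c, r)" "c \<in> carrier C" "r \<in> NA" by blast
    have "\<alpha> a (h u ?p) \<in> carrier C \<times> ?NA'"
      unfolding cr(1) by (rule \<alpha>(3)[OF a(1) cr(2,3)])
    then show "d \<otimes>\<^bsub>P\<^esub> u \<in> M" using cl hm[OF cl] h(2)[of a] a by (simp add: M_def)
  next
    fix d u assume d: "d \<in> amalg_inr A B C f g ` (carrier B - g ` carrier C)"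
      and u: "u \<in> insert \<one>\<^bsub>P\<^esub> M"
    obtain b where b: "b \<in> carrier B - g ` carrier C" "d = amalg_inr A B C f g b" using d by blast
    have cl: "d \<in> carrier P" "u \<in> carrier P"
      using b u hom_in_carrier[OF amalg_inr_hom, of b] by (auto simp: M_def)
    have "h u ?p \<in> carrier C \<times> NB"
      using u h1 p unfolding M_def NA' by (auto simp: NB_def)
    then obtain c r where cr: "h u ?p = (c, r)" "c \<in> carrier C" "r \<in> NB" by blast
    have "\<beta> b (h u ?p) \<in> carrier C \<times> ?NB'"
      unfolding cr(1) by (rule \<beta>(3)[OF b(1) cr(2,3)])
    then show "d \<otimes>\<^bsub>P\<^esub> u \<in> N" using cl hm[OF cl] h(3)[of b] b by (simp add: N_def)
  qed
qed

lemma generate_amalg: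
  assumes X: "X \<subseteq> carrier A" "generate A X = carrier A"
    and Y: "Y \<subseteq> carrier B" "generate B Y = carrier B"
  shows "generate P (amalg_inl A B C f g ` X \<union> amalg_inr A B C f g ` Y) = carrier P"
    (is "generate P ?S = _")
proof -
  interpret P: group P by (rule group_P)
  interpret l: group_hom A P "amalg_inl A B C f g" by unfold_locales (rule amalg_inl_hom)
  interpret r: group_hom B P "amalg_inr A B C f g" by unfold_locales (rule amalg_inr_hom)
  have S: "?S \<subseteq> carrier P" using X(1) Y(1) by auto
  interpret S: subgroup "generate P ?S" P by (rule P.generate_is_subgroup[OF S])
  have l: "amalg_inl A B C f g a \<in> generate P ?S" if "a \<in> carrier A" for a
    using that l.generate_img[OF X(1)] X(2) P.mono_generate[of "amalg_inl A B C f g ` X" ?S] by blast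
  have r: "amalg_inr A B C f g b \<in> generate P ?S" if "b \<in> carrier B" for b
    using that r.generate_img[OF Y(1)] Y(2) P.mono_generate[of "amalg_inr A B C f g ` Y" ?S] by blast
  have "R `` {w} \<in> generate P ?S" if "w \<in> amalg_words A B" for w
    using that
  proof (induction w rule: lists.induct)
    case Nil
    show ?case using S.one_closed by (simp add: one_P)
  next
    case (Cons x w)
    have "R `` {[x]} \<in> generate P ?S"
      using Cons.hyps(1) l r by (cases x) (auto simp: amalg_inl_def amalg_inr_def)
    moreover have "R `` {x # w} = R `` {[x]} \<otimes>\<^bsub>P\<^esub> R `` {w}"
      using class_mult[of "[x]" w] Cons.hyps by simp
    ultimately show ?case using Cons.IH by simp
  qed
  then have "carrier P \<subseteq> generate P ?S"
    unfolding subset_iff carrier_P by blast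
  then show ?thesis using S.subset by (rule equalityI[rotated])
qed

end

section \<open>Girth of the amalgamated product\<close>

theorem proposition1p3:
  fixes A :: "('a, 'm) monoid_scheme" and B :: "('b, 'n) monoid_scheme"
    and C :: "('c, 'k) monoid_scheme" and f :: "'c \<Rightarrow> 'a" and g :: "'c \<Rightarrow> 'b"
  assumes "group A" and "group B" and "group C"
    and "finitely_generated A" and "finitely_generated B"
    and "f \<in> mon C A" and "g \<in> mon C B"
    and "f ` carrier C \<subset> carrier A" and "g ` carrier C \<subset> carrier B"
    and "max (subgroup_index A (f ` carrier C)) (subgroup_index B (g ` carrier C)) \<ge> 3"
  shows "girth (amalgamated_product A B C f g) = \<infinity>"
proof -
  have fg: "f \<in> hom C A" "g \<in> hom C B" using assms(6,7) by (auto simp: mon_def)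
  interpret amalgam A B C f g
    using assms(1-3) fg by (simp add: amalgam_def amalgam_axioms_def)
  interpret f: group_hom C A f by unfold_locales (rule fg)
  interpret g: group_hom C B g by unfold_locales (rule fg)
  interpret P: group P by (rule group_P)
  interpret l: group_hom A P "amalg_inl A B C f g" by unfold_locales (rule amalg_inl_hom)
  interpret r: group_hom B P "amalg_inr A B C f g" by unfold_locales (rule amalg_inr_hom)
  let ?H = "f ` carrier C" and ?K = "g ` carrier C"
  note H = f.img_is_subgroup and K = g.img_is_subgroup
  let ?D = "amalg_inl A B C f g ` (carrier A - ?H)" and ?E = "amalg_inr A B C f g ` (carrier B - ?K)"
  obtain M N where MN: "M \<subseteq> carrier P" "N \<subseteq> carrier P" "M \<inter> N = {}" "\<one>\<^bsub>P\<^esub> \<notin> M \<union> N"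
    and DN: "\<And>d u. d \<in> ?D \<Longrightarrow> u \<in> insert \<one>\<^bsub>P\<^esub> N \<Longrightarrow> d \<otimes>\<^bsub>P\<^esub> u \<in> M"
    and EM: "\<And>d u. d \<in> ?E \<Longrightarrow> u \<in> insert \<one>\<^bsub>P\<^esub> M \<Longrightarrow> d \<otimes>\<^bsub>P\<^esub> u \<in> N"
    using normal_form_partition[OF assms(6,7)] by blast
  have MN': "N \<inter> M = {}" "\<one>\<^bsub>P\<^esub> \<notin> N \<union> M" using MN by auto
  have D: "?D \<subseteq> carrier P" and E: "?E \<subseteq> carrier P" by auto
  have Dinv: "inv\<^bsub>P\<^esub> d \<in> ?D" if d: "d \<in> ?D" for d
  proof -
    obtain a where a: "a \<in> carrier A - ?H" "d = amalg_inl A B C f g a" using d by blast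
    have "inv\<^bsub>A\<^esub> a \<in> carrier A - ?H"
      using a(1) subgroup.m_inv_closed[OF H, of "inv\<^bsub>A\<^esub> a"] by auto
    then show ?thesis using a l.hom_inv[of a] by (metis Diff_iff imageI)
  qed
  have Einv: "inv\<^bsub>P\<^esub> d \<in> ?E" if d: "d \<in> ?E" for d
  proof -
    obtain b where b: "b \<in> carrier B - ?K" "d = amalg_inr A B C f g b" using d by blast
    have "inv\<^bsub>B\<^esub> b \<in> carrier B - ?K"
      using b(1) subgroup.m_inv_closed[OF K, of "inv\<^bsub>B\<^esub> b"] by auto
    then show ?thesis using b r.hom_inv[of b] by (metis Diff_iff imageI)
  qed
  obtain X where X: "finite X" "X \<subseteq> carrier A - ?H" "generate A X = carrier A"
    using A.finitely_generated_outside_subgroup[OF assms(4) H assms(8)] by blast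
  obtain Y where Y: "finite Y" "Y \<subseteq> carrier B - ?K" "generate B Y = carrier B"
    using B.finitely_generated_outside_subgroup[OF assms(5) K assms(9)] by blast
  let ?X = "amalg_inl A B C f g ` X" and ?Y = "amalg_inr A B C f g ` Y"
  have XY: "finite ?X" "?X \<subseteq> ?D" "finite ?Y" "?Y \<subseteq> ?E" using X Y by auto
  have gen: "generate P (?X \<union> ?Y) = carrier P"
    using generate_amalg X Y by blast
  then have gen': "generate P (?Y \<union> ?X) = carrier P" by (simp add: Un_commute)
  \<comment> \<open>The factor of index at least 3 supplies the two elements in different left and
    right cosets; the other supplies the single element \<open>b\<close> of the alternating words,
    so the second case swaps the factors.\<close>
  consider "3 \<le> subgroup_index A ?H" | "3 \<le> subgroup_index B ?K"
    using assms(10) by (auto simp: max_def split: if_splits)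
  then show ?thesis
  proof cases
    case 1
    obtain a a' where a: "a \<in> carrier A - ?H" "a' \<in> carrier A - ?H"
      "inv\<^bsub>A\<^esub> a \<otimes>\<^bsub>A\<^esub> a' \<in> carrier A - ?H" "a \<otimes>\<^bsub>A\<^esub> inv\<^bsub>A\<^esub> a' \<in> carrier A - ?H"
      using A.exists_distinct_left_right_cosets[OF H 1] by blast
    obtain b where b: "b \<in> carrier B - ?K" using assms(9) by blast
    let ?i = "amalg_inl A B C f g"
    have "inv\<^bsub>P\<^esub> (?i a) \<otimes>\<^bsub>P\<^esub> ?i a' = ?i (inv\<^bsub>A\<^esub> a \<otimes>\<^bsub>A\<^esub> a')"
      "?i a \<otimes>\<^bsub>P\<^esub> inv\<^bsub>P\<^esub> (?i a') = ?i (a \<otimes>\<^bsub>A\<^esub> inv\<^bsub>A\<^esub> a')"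
      using a by simp_all
    then have a': "inv\<^bsub>P\<^esub> (?i a) \<otimes>\<^bsub>P\<^esub> ?i a' \<in> ?D" "?i a \<otimes>\<^bsub>P\<^esub> inv\<^bsub>P\<^esub> (?i a') \<in> ?D"
      using a(3,4) by (metis imageI)+
    show ?thesis
      by (rule P.girth_eq_infinity_alternating[OF D Dinv E Einv MN DN EM imageI[OF a(1)]
            imageI[OF a(2)] a' imageI[OF b] XY gen])
  next
    case 2
    obtain b b' where b: "b \<in> carrier B - ?K" "b' \<in> carrier B - ?K"
      "inv\<^bsub>B\<^esub> b \<otimes>\<^bsub>B\<^esub> b' \<in> carrier B - ?K" "b \<otimes>\<^bsub>B\<^esub> inv\<^bsub>B\<^esub> b' \<in> carrier B - ?K"
      using B.exists_distinct_left_right_cosets[OF K 2] by blast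
    obtain a where a: "a \<in> carrier A - ?H" using assms(8) by blast
    let ?i = "amalg_inr A B C f g"
    have "inv\<^bsub>P\<^esub> (?i b) \<otimes>\<^bsub>P\<^esub> ?i b' = ?i (inv\<^bsub>B\<^esub> b \<otimes>\<^bsub>B\<^esub> b')"
      "?i b \<otimes>\<^bsub>P\<^esub> inv\<^bsub>P\<^esub> (?i b') = ?i (b \<otimes>\<^bsub>B\<^esub> inv\<^bsub>B\<^esub> b')"
      using b by simp_all
    then have b': "inv\<^bsub>P\<^esub> (?i b) \<otimes>\<^bsub>P\<^esub> ?i b' \<in> ?E" "?i b \<otimes>\<^bsub>P\<^esub> inv\<^bsub>P\<^esub> (?i b') \<in> ?E"
      using b(3,4) by (metis imageI)+
    show ?thesis
      by (rule P.girth_eq_infinity_alternating[OF E Einv D Dinv MN(2,1) MN' EM DN imageI[OF b(1)]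
            imageI[OF b(2)] b' imageI[OF a] XY(3,4,1,2) gen'])
  qed
qed

end
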